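(* Let $K_1,K_2>0$ be small enough so that $p(K_1)+p(K_2)>1$. Then for any $j\ge 0$, $$\mathbb{P}\left(\exists\,\tau\in[0,1] \text{ such that } \forall t\ge 0,\ -j-K_1\sqrt{t}\le S_0^\tau(t)\le j+K_2\sqrt{t}\right)=0.$$
   Context: Let $\mathbb{Z}^2_{even}=\{(x,t)\in\mathbb{Z}^2: x+t \text{ is even}\}$. Dynamical discrete web: the processes $(\xi_z^\tau)_{\tau\ge 0}$, $z\in\mathbb{Z}^2_{even}$, are independent, right-continuous, $\{-1,+1\}$-valued; for each $z$, $\xi_z^0$ is uniform on $\{-1,+1\}$, and at each ring of a rate-one Poisson clock at $z$ the value is replaced by a fresh independent uniform $\{-1,+1\}$ value. For each $\tau\geq 0$, $S_0^\tau$ is the path with $S_0^\tau(0)=0$, $S_0^\tau(t+1)=S_0^\tau(t)+\xi^\tau_{(S_0^\tau(t),t)}$ for integers $t\ge 0$, linearly interpolated between integer times. For $K\in(0,\infty)$, $p(K)\in(0,1)$ is the solution $p$ of $$\frac{\sin(\pi p/2)\,\Gamma(1+p/2)}{\pi}\sum_{n=1}^\infty\frac{(\sqrt{2}K)^n}{n!}\,\Gamma((n-p)/2)=1;$$ $p(\cdot)$ is a continuous decreasing function on $(0,\infty)$ with $\lim_{K\to\infty}p(K)=0$ and $\lim_{K\downarrow0}p(K)=1$. *)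

theory Defs
  imports "HOL-Probability.Probability"
begin

definition even_lattice :: "(int \<times> int) set" where
  "even_lattice = {(x, t). even (x + t)}"

text \<open>
  Time of the \<open>n\<close>-th ring of a clock whose successive waiting times are \<open>w 0, w 1, \<dots>\<close>;
  index \<open>0\<close> stands for the starting time \<open>0\<close>, so proper rings have index at least \<open>1\<close>.
\<close>
definition ring_time :: "(nat \<Rightarrow> real) \<Rightarrow> nat \<Rightarrow> real" where
  "ring_time w n = (\<Sum>i<n. w i)"

text \<open>
  \<open>\<xi> z \<tau>\<close> is the arrow at \<open>z\<close> at dynamical time \<open>\<tau>\<close>. The rate-one Poisson clock at \<open>z\<close> is
  given by its i.i.d. exponential waiting times \<open>W z n\<close>; \<open>U z 0\<close> is the initial value at \<open>z\<close> and
  \<open>U z n\<close>, for \<open>n \<ge> 1\<close>, the fresh value adopted at the \<open>n\<close>-th ring. Independence is joint over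
  all waiting times and all values at all lattice points. The evolution rule is only
  required almost surely, since the exponential law forces positive waiting times and
  divergent ring times only almost surely.
\<close>
locale dynamical_discrete_web = prob_space M for M :: "'w measure" +
  fixes \<xi> :: "int \<times> int \<Rightarrow> real \<Rightarrow> 'w \<Rightarrow> int"
    and W :: "int \<times> int \<Rightarrow> nat \<Rightarrow> 'w \<Rightarrow> real"
    and U :: "int \<times> int \<Rightarrow> nat \<Rightarrow> 'w \<Rightarrow> int"
  assumes waiting_time:
      "\<And>z n. z \<in> even_lattice \<Longrightarrow> distributed M lborel (W z n) (exponential_density 1)"
    and value_measurable:
      "\<And>z n. z \<in> even_lattice \<Longrightarrow> random_variable (count_space UNIV) (U z n)"
    and value_uniform:
      "\<And>z n. z \<in> even_lattice \<Longrightarrow>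
         distr M (count_space UNIV) (U z n) = measure_pmf (pmf_of_set {-1, 1})"
    and indep:
      "indep_vars (\<lambda>_. borel)
         (\<lambda>i. case i of Inl (z, n) \<Rightarrow> W z n | Inr (z, n) \<Rightarrow> (\<lambda>\<omega>. real_of_int (U z n \<omega>)))
         ((even_lattice \<times> UNIV) <+> (even_lattice \<times> UNIV))"
    and process_measurable:
      "\<And>z \<tau>. z \<in> even_lattice \<Longrightarrow> 0 \<le> \<tau> \<Longrightarrow> random_variable (count_space UNIV) (\<xi> z \<tau>)"
    and process_values:
      "\<And>z \<tau> \<omega>. z \<in> even_lattice \<Longrightarrow> 0 \<le> \<tau> \<Longrightarrow> \<omega> \<in> space M \<Longrightarrow> \<xi> z \<tau> \<omega> \<in> {-1, 1}"
    and right_continuous: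
      "\<And>z \<tau> \<omega>. z \<in> even_lattice \<Longrightarrow> 0 \<le> \<tau> \<Longrightarrow> \<omega> \<in> space M \<Longrightarrow>
         continuous (at_right \<tau>) (\<lambda>s. \<xi> z s \<omega>)"
    and evolution:
      "AE \<omega> in M. \<forall>z\<in>even_lattice. \<forall>n \<tau>.
         ring_time (\<lambda>i. W z i \<omega>) n \<le> \<tau> \<and> \<tau> < ring_time (\<lambda>i. W z i \<omega>) (Suc n) \<longrightarrow>
         \<xi> z \<tau> \<omega> = U z n \<omega>"

text \<open>The path from the origin in a fixed arrow configuration \<open>\<eta>\<close>, at integer times.\<close>
primrec walk :: "(int \<times> int \<Rightarrow> int) \<Rightarrow> nat \<Rightarrow> int" where
  "walk \<eta> 0 = 0"
| "walk \<eta> (Suc t) = walk \<eta> t + \<eta> (walk \<eta> t, int t)"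

definition interpolate :: "(nat \<Rightarrow> int) \<Rightarrow> real \<Rightarrow> real" where
  "interpolate s t =
     (1 - frac t) * real_of_int (s (nat \<lfloor>t\<rfloor>)) + frac t * real_of_int (s (Suc (nat \<lfloor>t\<rfloor>)))"

definition S0 :: "(int \<times> int \<Rightarrow> real \<Rightarrow> 'w \<Rightarrow> int) \<Rightarrow> real \<Rightarrow> 'w \<Rightarrow> real \<Rightarrow> real" where
  "S0 \<xi> \<tau> \<omega> t = interpolate (walk (\<lambda>z. \<xi> z \<tau> \<omega>)) t"

text \<open>
  \<open>is_p K p\<close> says \<open>p = p(K)\<close>. The summation index is shifted, as the series starts at \<open>n = 1\<close>;
  the series converges absolutely for every \<open>K\<close> and every \<open>p\<close> in the open unit interval.
\<close>
definition is_p :: "real \<Rightarrow> real \<Rightarrow> bool" where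
  "is_p K p \<longleftrightarrow> 0 < p \<and> p < 1 \<and>
     sin (pi * p / 2) * Gamma (1 + p / 2) / pi *
       (\<Sum>n. (sqrt 2 * K) ^ Suc n / fact (Suc n) * Gamma ((real (Suc n) - p) / 2)) = 1"

end

theory Submission
  imports Defs "HOL-Real_Asymp.Real_Asymp"
begin

text \<open>
  Why the theorem is true. Cut the dynamical time interval \<open>[0, 1]\<close> into short intervals of length
  \<open>\<delta>\<close>. While \<open>\<tau>\<close> runs through one of them, the arrow at a site changes only if the clock of that
  site rings. Let the upper walk follow the common arrow at the sites without a ring and the arrow
  \<open>+1\<close> at all others, and let the lower walk follow \<open>-1\<close> at those others. By parity, walks with
  ordered arrows do not cross (\<open>walk_mono\<close>), so every path \<open>S\<^sub>0\<close> of the short interval lies between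
  the two. An exceptional \<open>\<tau>\<close> in the interval thus forces the upper walk to stay above the lower
  barrier and the lower walk to stay below the upper barrier.

  Both are random walks with a drift of at most \<open>\<delta>\<close> towards safety. Up to time \<open>n = m\<^sup>2\<close> with
  \<open>m = const / \<delta>\<close> that drift is harmless, and a walk respects the barrier \<open>j + K sqrt t\<close> up to time \<open>n\<close>
  with probability \<open>O(m powr (- q))\<close> for each \<open>q < p(K)\<close>. The two events pull in opposite directions (one is
  increasing, the other decreasing in the arrows), so the probability that both occur is at most
  of the order of the product \<open>m powr (- (q\<^sub>1 + q\<^sub>2))\<close>. There are of the order of \<open>m\<close> short intervals, and
  \<open>q\<^sub>1 + q\<^sub>2 > 1\<close> can be arranged since \<open>p(K\<^sub>1) + p(K\<^sub>2) > 1\<close>; the union bound tends to \<open>0\<close> as \<open>m\<close> grows.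

  The exponent \<open>p(K)\<close> enters through a superposition of the exponential martingales of Brownian
  motion, \<open>h(x, t) = \<integral> (1 - exp (l x - l\<^sup>2 t / 2)) l powr (-1 - p) dl\<close> over \<open>l > 0\<close>. It scales like
  \<open>t powr (p / 2)\<close> times a decreasing function of \<open>x / sqrt t\<close>, and expanding \<open>exp (l x)\<close> turns the equation that
  defines \<open>p(K)\<close> into \<open>h(K sqrt t, t) = 0\<close> (\<open>integral_barrier_integrand_eq_0\<close>). Taking \<open>q < p(K)\<close> instead
  of \<open>p(K)\<close> makes \<open>h\<close> strictly positive up to and slightly beyond the barrier. The slack absorbs the
  discreteness of the walk, the drift \<open>\<delta>\<close> and the constant \<open>j\<close>, so that a small modification of \<open>h\<close>
  is a supermartingale for the walk that is at least of the order \<open>t powr (q / 2)\<close> as long as the walk has not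
  crossed (\<open>barrier_supermartingale\<close>).

  Negative correlation is built into the same computation: the product of the two supermartingales,
  one evaluated at the upper and one at the lower walk, is again a supermartingale
  (\<open>product_supermartingale\<close>). At each step the two walks either look at different sites, whose
  arrows are independent, or at the same site, where Chebyshev's inequality for an increasing and
  a decreasing function applies.
\<close>

section \<open>The integral behind the survival exponent\<close>

text \<open>
  Under \<open>v = l sqrt t\<close> and \<open>y = x / sqrt t\<close> this is, up to the factor \<open>t powr (p / 2)\<close>, the integrand of
  the function \<open>h\<close> described above.
\<close>
definition barrier_integrand :: "real \<Rightarrow> real \<Rightarrow> real \<Rightarrow> real" where
  "barrier_integrand p y v = (1 - exp (v * y - v\<^sup>2 / 2)) * v powr (-1 - p)"

lemma abs_one_minus_exp_le: "\<bar>1 - exp u\<bar> \<le> \<bar>u\<bar> * exp \<bar>u\<bar>" for u :: real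
proof (cases "u \<ge> 0")
  case True
  have "1 + (-u) \<le> exp (-u)" by (rule exp_ge_add_one_self)
  hence "(1 - u) * exp u \<le> exp (-u) * exp u" by (intro mult_right_mono) auto
  hence "(1 - u) * exp u \<le> 1" by (simp flip: exp_add)
  thus ?thesis using True by (simp add: algebra_simps)
next
  case False
  have "1 + u \<le> exp u" by (rule exp_ge_add_one_self)
  hence "1 - exp u \<le> -u" by linarith
  also have "-u \<le> (-u) * exp (-u)" using False by simp
  finally show ?thesis using False by simp
qed

text \<open>
  Near \<open>0\<close> the factor \<open>1 - exp (w v)\<close> is of order \<open>v\<close>, which turns the singularity \<open>v powr (-1 - p)\<close>
  into the integrable \<open>v powr (- p)\<close>; this is where \<open>p < 1\<close> matters.
\<close>
lemma absolutely_integrable_one_minus_exp: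
  fixes w :: "real \<Rightarrow> real"
  assumes p: "p < 1" and c: "c \<ge> 0" and C: "C \<ge> 0"
    and cont: "continuous_on {0<..c} w" and bound: "\<And>v. 0 < v \<Longrightarrow> v \<le> c \<Longrightarrow> \<bar>w v\<bar> \<le> C * v"
  shows "(\<lambda>v. (1 - exp (w v)) * v powr (-1 - p)) absolutely_integrable_on {0<..c}"
proof (rule measurable_bounded_by_integrable_imp_absolutely_integrable)
  let ?D = "C * exp (C * c)"
  show "(\<lambda>v. (1 - exp (w v)) * v powr (-1 - p)) \<in> borel_measurable (lebesgue_on {0<..c})"
    by (intro continuous_imp_measurable_on_sets_lebesgue continuous_intros cont) auto
  show "(\<lambda>v. ?D * v powr (-p)) integrable_on {0<..c}"
    using integrable_on_powr_from_0'[of "-p" c] p c by (intro integrable_on_mult_right) auto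
  fix v :: real assume v: "v \<in> {0<..c}"
  have u: "\<bar>w v\<bar> \<le> C * v" using bound v by auto
  also have "\<dots> \<le> C * c" using v C by (intro mult_left_mono) auto
  finally have u2: "\<bar>w v\<bar> \<le> C * c" .
  have "\<bar>1 - exp (w v)\<bar> \<le> \<bar>w v\<bar> * exp \<bar>w v\<bar>" by (rule abs_one_minus_exp_le)
  also have "\<dots> \<le> (C * v) * exp (C * c)" using u u2 v C by (intro mult_mono) auto
  finally have "norm ((1 - exp (w v)) * v powr (-1 - p)) \<le> (C * v) * exp (C * c) * v powr (-1-p)"
    by (simp add: abs_mult mult_right_mono)
  also have "\<dots> = ?D * (v powr 1 * v powr (-1-p))" using v by simp
  also have "\<dots> = ?D * v powr (-p)" by (subst powr_add[symmetric]) simp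
  finally show "norm ((1 - exp (w v)) * v powr (-1 - p)) \<le> ?D * v powr (-p)" .
qed auto

text \<open>
  The behaviour at \<open>0\<close> needs \<open>p < 1\<close>, the one at infinity \<open>p > 0\<close>.
\<close>
lemma absolutely_integrable_barrier_integrand:
  assumes p: "0 < p" "p < 1"
  shows "barrier_integrand p y absolutely_integrable_on {0<..}"
proof -
  have 1: "barrier_integrand p y absolutely_integrable_on {0<..1}"
    unfolding barrier_integrand_def
  proof (rule absolutely_integrable_one_minus_exp)
    fix v :: real assume v: "0 < v" "v \<le> 1"
    have "\<bar>v * y - v\<^sup>2/2\<bar> \<le> \<bar>v * y\<bar> + \<bar>v\<^sup>2/2\<bar>" by linarith
    also have "\<dots> = (\<bar>y\<bar> + v/2) * v" using v by (simp add: abs_mult algebra_simps power2_eq_square)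
    also have "\<dots> \<le> (\<bar>y\<bar> + 1) * v" using v by (intro mult_right_mono) auto
    finally show "\<bar>v * y - v\<^sup>2/2\<bar> \<le> (\<bar>y\<bar> + 1) * v" .
  qed (use p in \<open>auto intro!: continuous_intros\<close>)
  have 2: "barrier_integrand p y absolutely_integrable_on {1..}"
  proof (rule measurable_bounded_by_integrable_imp_absolutely_integrable)
    let ?C = "1 + exp (y\<^sup>2 / 2)"
    show "barrier_integrand p y \<in> borel_measurable (lebesgue_on {1..})"
      unfolding barrier_integrand_def
      by (intro continuous_imp_measurable_on_sets_lebesgue continuous_intros) auto
    show "(\<lambda>v. ?C * v powr (-1-p)) integrable_on {1..}"
      using has_integral_powr_to_inf[of "-1-p" 1] p by (intro integrable_on_mult_right) (auto simp: integrable_on_def)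
    fix v :: real assume v: "v \<in> {1..}"
    have "(v - y)\<^sup>2 \<ge> 0" by simp
    hence "v * y - v\<^sup>2/2 \<le> y\<^sup>2/2" by (simp add: power2_eq_square algebra_simps)
    hence "\<bar>1 - exp (v * y - v\<^sup>2/2)\<bar> \<le> ?C"
      using exp_le_cancel_iff[of "v * y - v\<^sup>2/2" "y\<^sup>2/2"] exp_gt_zero[of "v * y - v\<^sup>2/2"] by linarith
    thus "norm (barrier_integrand p y v) \<le> ?C * v powr (-1-p)"
      unfolding barrier_integrand_def by (simp add: abs_mult mult_right_mono)
  qed auto
  have "barrier_integrand p y absolutely_integrable_on ({0<..1} \<union> {1..})"
    by (rule set_integrable_Un[OF 1 2]) auto
  also have "{0<..(1::real)} \<union> {1..} = {0<..}" by auto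
  finally show ?thesis .
qed

lemma barrier_integrand_integrable_on:
  assumes "0 < p" "p < 1" "S \<subseteq> {0<..}" "S \<in> sets lebesgue"
  shows "barrier_integrand p y integrable_on S"
  using set_integrable_subset[OF absolutely_integrable_barrier_integrand[OF assms(1,2)], of S] assms(3,4)
  by (auto dest: set_lebesgue_integral_eq_integral(1))

text \<open>
  The substitution \<open>t = v\<^sup>2 / 2\<close> in Euler's integral for the Gamma function.
\<close>
lemma gaussian_moment:
  fixes s :: real
  assumes s: "s > 0"
  shows "((\<lambda>v. v powr (s - 1) * exp (- v\<^sup>2 / 2)) has_integral (2 powr (s/2 - 1) * Gamma (s/2))) {0<..}"
    and "(\<lambda>v. v powr (s - 1) * exp (- v\<^sup>2 / 2)) absolutely_integrable_on {0<..}"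
proof -
  define f where "f = (\<lambda>t::real. t powr (s/2 - 1) / exp t)"
  have img: "(\<lambda>v::real. v\<^sup>2/2) ` {0<..} = {0<..}"
  proof (intro equalityI subsetI)
    fix x :: real assume "x \<in> {0<..}"
    thus "x \<in> (\<lambda>v::real. v\<^sup>2/2) ` {0<..}" by (intro image_eqI[of _ _ "sqrt (2*x)"]) auto
  qed auto
  have "(f has_integral Gamma (s/2)) {0..}" unfolding f_def using Gamma_integral_real[of "s/2"] s by simp
  hence g: "(f has_integral Gamma (s/2)) {0<..}"
    by (subst has_integral_spike_set_eq[where T = "{0..}"])
       (auto intro!: negligible_subset[of "{0::real}"] empty_imp_negligible simp: f_def)
  have fa: "f absolutely_integrable_on {0<..}"
    by (rule nonnegative_absolutely_integrable_1) (use g in \<open>auto simp: integrable_on_def f_def\<close>)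
  have inj: "inj_on (\<lambda>v::real. v\<^sup>2/2) {0<..}" by (auto simp: inj_on_def)
  have eq: "\<bar>v\<bar> * f (v\<^sup>2/2) = 2 powr (1 - s/2) * (v powr (s - 1) * exp (- v\<^sup>2 / 2))" if "v \<in> {0<..}" for v
  proof -
    have v: "v > 0" using that by auto
    have "v\<^sup>2 = v powr 2" using v by simp
    hence "(v\<^sup>2/2) powr (s/2 - 1) = (v powr 2) powr (s/2-1) / 2 powr (s/2-1)" by (simp add: powr_divide)
    also have "\<dots> = v powr (s-2) * 2 powr (1 - s/2)"
      by (simp add: powr_powr algebra_simps powr_diff divide_simps flip: powr_add)
    finally have 1: "(v\<^sup>2/2) powr (s/2 - 1) = v powr (s-2) * 2 powr (1 - s/2)" .
    have "v * v powr (s - 2) = v powr 1 * v powr (s-2)" using v by simp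
    also have "\<dots> = v powr (s-1)" by (subst powr_add[symmetric]) simp
    finally have 2: "v * v powr (s - 2) = v powr (s - 1)" .
    have e: "exp (- v\<^sup>2/2) = inverse (exp (v\<^sup>2/2))" using exp_minus[of "v\<^sup>2/2"] by simp
    have "\<bar>v\<bar> * f (v\<^sup>2/2) = (v * v powr (s - 2)) * 2 powr (1 - s/2) * exp (- v\<^sup>2/2)"
      using v unfolding f_def 1 e by (simp only: divide_inverse abs_of_pos mult.assoc)
    thus ?thesis unfolding 2 by simp
  qed
  have "(\<lambda>v. \<bar>v\<bar> * f (v\<^sup>2/2)) absolutely_integrable_on {0<..} \<and>
        integral {0<..} (\<lambda>v. \<bar>v\<bar> * f (v\<^sup>2/2)) = Gamma (s/2)"
    by (subst has_absolute_integral_change_of_variables_1'[where g = "\<lambda>v. v\<^sup>2/2"])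
       (use inj in \<open>auto simp: img fa integral_unique[OF g] intro!: derivative_eq_intros\<close>)
  hence cd: "(\<lambda>v. \<bar>v\<bar> * f (v\<^sup>2/2)) absolutely_integrable_on {0<..}"
        "integral {0<..} (\<lambda>v. \<bar>v\<bar> * f (v\<^sup>2/2)) = Gamma (s/2)" by blast+
  have c: "(\<lambda>v. 2 powr (1 - s/2) * (v powr (s - 1) * exp (- v\<^sup>2 / 2))) absolutely_integrable_on {0<..}"
  proof (subst set_integrable_cong[OF refl refl])
    fix v :: real assume "v \<in> {0<..}"
    thus "2 powr (1 - s/2) * (v powr (s - 1) * exp (- v\<^sup>2 / 2)) = \<bar>v\<bar> * f (v\<^sup>2/2)"
      by (rule eq[symmetric])
  qed (rule cd(1))
  have d: "integral {0<..} (\<lambda>v. 2 powr (1 - s/2) * (v powr (s - 1) * exp (- v\<^sup>2 / 2))) = Gamma (s/2)"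
    unfolding cd(2)[symmetric] by (rule integral_cong) (rule eq[symmetric])
  have c': "(\<lambda>v. 2 powr (s/2-1) * (2 powr (1 - s/2) * (v powr (s - 1) * exp (- v\<^sup>2 / 2)))) absolutely_integrable_on {0<..}"
    by (intro set_integrable_mult_right c)
  have d': "integral {0<..} (\<lambda>v. 2 powr (s/2-1) * (2 powr (1 - s/2) * (v powr (s - 1) * exp (- v\<^sup>2 / 2)))) = 2 powr (s/2-1) * Gamma (s/2)"
    unfolding d[symmetric] by (rule integral_mult_right)
  have e: "2 powr (s/2-1) * (2 powr (1 - s/2) * x) = x" for x :: real
  proof -
    have "2 powr (s/2-1) * 2 powr (1 - s/2) = (1::real)" by (subst powr_add[symmetric]) simp
    thus ?thesis by (simp add: mult.assoc[symmetric])
  qed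
  show ai: "(\<lambda>v. v powr (s - 1) * exp (- v\<^sup>2 / 2)) absolutely_integrable_on {0<..}"
    using c' unfolding e .
  show "((\<lambda>v. v powr (s - 1) * exp (- v\<^sup>2 / 2)) has_integral (2 powr (s/2 - 1) * Gamma (s/2))) {0<..}"
    using d' ai unfolding e has_integral_iff by (auto dest: set_lebesgue_integral_eq_integral(1))
qed

text \<open>
  Integration by parts: the derivative of \<open>(1 - exp (- v\<^sup>2 / 2)) * v powr (- p)\<close> is a Gaussian moment
  integrand minus \<open>p\<close> times the integrand in question, and the boundary terms vanish at \<open>0\<close> (as
  \<open>p < 2\<close>) and at infinity (as \<open>p > 0\<close>).
\<close>
lemma integral_barrier_integrand_0:
  assumes p: "0 < p" "p < 1"
  shows "integral {0<..} (barrier_integrand p 0) = 2 powr (-p/2) * Gamma (1 - p/2) / p"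
proof -
  define F where "F = (\<lambda>v::real. (1 - exp (- v\<^sup>2/2)) * v powr (-p))"
  define f where "f = (\<lambda>v::real. v powr ((2 - p) - 1) * exp (- v\<^sup>2/2) - p * barrier_integrand p 0 v)"
  have int1: "(\<lambda>v::real. v powr ((2 - p) - 1) * exp (- v\<^sup>2/2)) absolutely_integrable_on {0<..}"
    using gaussian_moment(2)[of "2-p"] p by simp
  have int2: "barrier_integrand p 0 absolutely_integrable_on {0<..}"
    by (rule absolutely_integrable_barrier_integrand[OF p])
  have fint: "f absolutely_integrable_on {0<..}"
    unfolding f_def by (intro set_integral_diff int1 set_integrable_mult_right int2)
  have der: "(F has_real_derivative f v) (at v)" if "v > 0" for v
  proof -
    have "v powr (1 - p) = v powr 1 * v powr (-p)" using that by (subst powr_add[symmetric]) simp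
    hence 1: "v powr (1 - p) = v * v powr (-p)" using that by simp
    have e: "-p - 1 = -1 - p" by simp
    have "((\<lambda>v. 1 - exp (- v\<^sup>2/2)) has_real_derivative v * exp (- v\<^sup>2/2)) (at v)"
      by (auto intro!: derivative_eq_intros)
    moreover have "((\<lambda>v. v powr (-p)) has_real_derivative (-p) * v powr (-1-p)) (at v)"
      using has_real_derivative_powr[OF that, of "-p"] by (simp only: e)
    ultimately have "(F has_real_derivative
        (1 - exp (- v\<^sup>2/2)) * ((-p) * v powr (-1-p)) + v * exp (- v\<^sup>2/2) * v powr (-p)) (at v)"
      unfolding F_def by (rule DERIV_mult')
    also have "(1 - exp (- v\<^sup>2/2)) * ((-p) * v powr (-1-p)) + v * exp (- v\<^sup>2/2) * v powr (-p) = f v"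
      unfolding f_def barrier_integrand_def by (simp add: 1 algebra_simps)
    finally show ?thesis .
  qed
  \<comment> \<open>The fundamental theorem of calculus on compact intervals that exhaust the half-line.\<close>
  define I where "I = (\<lambda>k::nat. {1/real (Suc k)..real (Suc k)})"
  have Iint: "(f has_integral (F (real (Suc k)) - F (1/real (Suc k)))) (I k)" for k
    unfolding I_def
  proof (rule fundamental_theorem_of_calculus)
    fix x assume "x \<in> {1 / real (Suc k)..real (Suc k)}"
    moreover have "1 / real (Suc k) > 0" by simp
    ultimately have "x > 0" by (meson atLeastAtMost_iff less_le_trans)
    thus "(F has_vector_derivative f x) (at x within {1 / real (Suc k)..real (Suc k)})"
      using der has_field_derivative_at_within has_real_derivative_iff_has_vector_derivative by blast
  next
    have "1 / real (Suc k) \<le> 1" "1 \<le> real (Suc k)" by simp_all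
    thus "1 / real (Suc k) \<le> real (Suc k)" by linarith
  qed
  have sub: "I k \<subseteq> {0<..}" for k
  proof
    fix x assume "x \<in> I k"
    moreover have "1 / real (Suc k) > 0" by simp
    ultimately show "x \<in> {0<..}" unfolding I_def by (meson atLeastAtMost_iff greaterThan_iff less_le_trans)
  qed
  have Iint': "((\<lambda>v. if v \<in> I k then f v else 0) has_integral (F (real (Suc k)) - F (1/real (Suc k)))) {0<..}" for k
    using has_integral_on_superset[of "\<lambda>v. if v \<in> I k then f v else 0" _ "I k" "{0<..}"] sub Iint
    by (auto cong: has_integral_cong)
  have "(\<lambda>k. integral {0<..} (\<lambda>v. if v \<in> I k then f v else 0)) \<longlonglongrightarrow> integral {0<..} f"
  proof (rule dominated_convergence[where h = "\<lambda>v. norm (f v)"])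
    show "(\<lambda>v. norm (f v)) integrable_on {0<..}"
      using fint by (simp add: absolutely_integrable_on_def)
    fix v :: real assume v: "v \<in> {0<..}"
    have 1: "eventually (\<lambda>k. 1 / real (Suc k) < v) sequentially"
      by (rule order_tendstoD(2)[of _ 0]) (use v in \<open>auto intro: LIMSEQ_Suc lim_1_over_n simp del: of_nat_Suc\<close>)
    have 2: "eventually (\<lambda>k. real (Suc k) > v) sequentially"
      by real_asymp
    have "eventually (\<lambda>k. (if v \<in> I k then f v else 0) = f v) sequentially"
      using 1 2 by eventually_elim (auto simp: I_def simp del: of_nat_Suc)
    thus "(\<lambda>k. if v \<in> I k then f v else 0) \<longlonglongrightarrow> f v" by (rule tendsto_eventually)
  qed (use Iint' in \<open>auto simp: integrable_on_def\<close>)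
  hence "(\<lambda>k. F (real (Suc k)) - F (1/real (Suc k))) \<longlonglongrightarrow> integral {0<..} f"
    using Iint'[THEN integral_unique] by simp
  moreover have "(\<lambda>k. F (real (Suc k)) - F (1/real (Suc k))) \<longlonglongrightarrow> 0"
  proof -
    have F0: "0 \<le> F v" "F v \<le> v powr (-p)" for v unfolding F_def by (simp_all add: mult_left_le_one_le)
    have "(\<lambda>k. real (Suc k) powr (-p)) \<longlonglongrightarrow> 0" using p by real_asymp
    hence 1: "(\<lambda>k. F (real (Suc k))) \<longlonglongrightarrow> 0"
      by (rule tendsto_sandwich[OF _ _ tendsto_const, rotated 2]) (use F0 in \<open>auto simp del: of_nat_Suc\<close>)
    have F1: "F (1 / real (Suc k)) \<le> 1 / real (Suc k)" for k
    proof -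
      define v where "v = 1 / real (Suc k)"
      have v: "0 < v" "v \<le> 1" unfolding v_def by simp_all
      have "1 + (- v\<^sup>2/2) \<le> exp (- v\<^sup>2/2)" by (rule exp_ge_add_one_self)
      hence "1 - exp (- v\<^sup>2/2) \<le> v\<^sup>2" using zero_le_power2[of v] by linarith
      hence "F v \<le> v\<^sup>2 * v powr (-p)" unfolding F_def by (rule mult_right_mono) simp
      also have "v powr (-p) \<le> v powr (-1)" using v p by (intro powr_mono') auto
      hence "v\<^sup>2 * v powr (-p) \<le> v\<^sup>2 * v powr (-1)" by (rule mult_left_mono) simp
      also have "\<dots> = v" using v by (simp add: powr_minus power2_eq_square)
      finally show ?thesis unfolding v_def .
    qed
    have "(\<lambda>k. 1 / real (Suc k)) \<longlonglongrightarrow> 0" by (rule LIMSEQ_Suc[OF lim_1_over_n])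
    hence 2: "(\<lambda>k. F (1 / real (Suc k))) \<longlonglongrightarrow> 0"
      by (rule tendsto_sandwich[OF _ _ tendsto_const, rotated 2]) (use F0 F1 in \<open>auto simp del: of_nat_Suc\<close>)
    show ?thesis using tendsto_diff[OF 1 2] by simp
  qed
  ultimately have "integral {0<..} f = 0" by (rule LIMSEQ_unique)
  moreover have "integral {0<..} f = integral {0<..} (\<lambda>v::real. v powr ((2 - p) - 1) * exp (- v\<^sup>2/2)) - p * integral {0<..} (barrier_integrand p 0)"
    unfolding f_def using int1 int2
    by (subst integral_diff) (auto dest!: set_lebesgue_integral_eq_integral(1) intro!: integrable_on_mult_right simp: integral_mult_right)
  moreover have "integral {0<..} (\<lambda>v::real. v powr ((2 - p) - 1) * exp (- v\<^sup>2/2)) = 2 powr (- p/2) * Gamma (1 - p/2)"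
    using gaussian_moment(1)[of "2-p", THEN integral_unique] p by (simp add: diff_divide_distrib)
  ultimately show ?thesis using p by (simp add: field_simps)
qed

text \<open>
  The power series of \<open>exp (v * K) - 1\<close>, integrated termwise against
  \<open>exp (- v\<^sup>2 / 2) * v powr (-1 - p)\<close>, is up to the factor \<open>2 powr (- p / 2 - 1)\<close> the series that defines
  \<open>p(K)\<close>. By the reflection formula, the prefactor of that series is the reciprocal of the
  corresponding value for the \<open>K = 0\<close> integral, so the defining equation says that the two cancel.
\<close>
lemma integral_barrier_integrand_eq_0:
  assumes "is_p K p" and K: "K > 0"
  shows "integral {0<..} (barrier_integrand p K) = 0"
proof -
  have p: "0 < p" "p < 1"
    and eq: "sin (pi * p / 2) * Gamma (1 + p / 2) / pi *
       (\<Sum>n. (sqrt 2 * K) ^ Suc n / fact (Suc n) * Gamma ((real (Suc n) - p) / 2)) = 1"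
    using assms(1) by (auto simp: is_p_def)
  define m where "m = (\<lambda>n v::real. v powr ((real (Suc n) - p) - 1) * exp (- v\<^sup>2/2))"
  define f where "f = (\<lambda>n v. K ^ Suc n / fact (Suc n) * m n v)"
  define h where "h = (\<lambda>v. barrier_integrand p 0 v - barrier_integrand p K v)"
  define c where "c = (\<lambda>n. (sqrt 2 * K) ^ Suc n / fact (Suc n) * Gamma ((real (Suc n) - p) / 2))"
  have int: "barrier_integrand p y integrable_on {0<..}" for y
    using absolutely_integrable_barrier_integrand[OF p] by (rule set_lebesgue_integral_eq_integral(1))
  have hint: "h integrable_on {0<..}" unfolding h_def by (intro integrable_diff int)
  have mint: "(m n has_integral 2 powr ((real (Suc n) - p)/2 - 1) * Gamma ((real (Suc n) - p)/2)) {0<..}" for n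
    unfolding m_def by (rule gaussian_moment) (use p in auto)
  have fint: "(f n has_integral 2 powr (- p/2 - 1) * c n) {0<..}" for n
  proof -
    have "(f n has_integral K ^ Suc n / fact (Suc n) *
            (2 powr ((real (Suc n) - p)/2 - 1) * Gamma ((real (Suc n) - p)/2))) {0<..}"
      unfolding f_def by (rule has_integral_mult_right[OF mint])
    also have "2 powr ((real (Suc n) - p)/2 - 1) = 2 powr (-p/2 - 1) * sqrt 2 ^ Suc n"
    proof -
      have "sqrt 2 ^ Suc n = sqrt 2 powr real (Suc n)" by (rule powr_realpow[symmetric]) simp
      also have "\<dots> = 2 powr (real (Suc n) / 2)" by (subst powr_half_sqrt[symmetric]) (simp_all add: powr_powr)
      finally have "2 powr (-p/2 - 1) * sqrt 2 ^ Suc n = 2 powr (-p/2 - 1 + real (Suc n) / 2)"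
        by (simp add: powr_add)
      also have "-p/2 - 1 + real (Suc n) / 2 = (real (Suc n) - p)/2 - 1" by (simp add: field_simps)
      finally show ?thesis by simp
    qed
    also have "K ^ Suc n / fact (Suc n) * (2 powr (-p/2 - 1) * sqrt 2 ^ Suc n * Gamma ((real (Suc n) - p)/2))
        = 2 powr (- p/2 - 1) * c n"
      unfolding c_def power_mult_distrib by (simp del: power_Suc fact_Suc of_nat_Suc)
    finally show ?thesis .
  qed
  have fpos: "f n v \<ge> 0" for n v
    unfolding f_def m_def using K by (intro mult_nonneg_nonneg divide_nonneg_nonneg) auto
  have fsums: "(\<lambda>n. f n v) sums h v" if v: "v \<in> {0<..}" for v
  proof -
    have "(\<lambda>n. (v * K)^n / fact n) sums exp (v * K)"
      using exp_converges[of "v * K"] by (simp add: scaleR_conv_of_real divide_inverse mult.commute)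
    hence "(\<lambda>n. (v * K)^Suc n / fact (Suc n)) sums (exp (v * K) - 1)"
      by (subst sums_Suc_iff) (simp del: power_Suc fact_Suc)
    hence "(\<lambda>n. (exp (-v\<^sup>2/2) * v powr (-1-p)) * ((v * K)^Suc n / fact (Suc n)))
        sums ((exp (-v\<^sup>2/2) * v powr (-1-p)) * (exp (v * K) - 1))"
      by (rule sums_mult)
    also have "(exp (-v\<^sup>2/2) * v powr (-1-p)) * (exp (v * K) - 1) = h v"
    proof -
      have "exp (-v\<^sup>2/2) * exp (v * K) = exp (v * K - v\<^sup>2/2)" by (simp flip: exp_add)
      thus ?thesis unfolding h_def barrier_integrand_def by (simp add: algebra_simps)
    qed
    also have "(\<lambda>n. (exp (-v\<^sup>2/2) * v powr (-1-p)) * ((v * K)^Suc n / fact (Suc n))) = (\<lambda>n. f n v)"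
    proof
      fix n
      have "v powr (real (Suc n) - p - 1) = v powr (real (Suc n) + (- 1 - p))" by (simp add: algebra_simps)
      also have "\<dots> = v powr real (Suc n) * v powr (-1-p)" by (rule powr_add)
      also have "v powr real (Suc n) = v ^ Suc n" using v by (intro powr_realpow) auto
      finally show "(exp (-v\<^sup>2/2) * v powr (-1-p)) * ((v * K)^Suc n / fact (Suc n)) = f n v"
        unfolding f_def m_def power_mult_distrib
        by (simp add: divide_simps scaleR_conv_of_real del: power_Suc fact_Suc of_nat_Suc)
    qed
    finally show ?thesis .
  qed
  have "(\<lambda>N. integral {0<..} (\<lambda>v. \<Sum>n<N. f n v)) \<longlonglongrightarrow> integral {0<..} h"
  proof (rule dominated_convergence[OF _ hint])
    show "(\<lambda>v. \<Sum>n<N. f n v) integrable_on {0<..}" for N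
      using fint by (intro integrable_sum) (auto simp: integrable_on_def)
    fix v :: real assume v: "v \<in> {0<..}"
    show "norm (\<Sum>n<N. f n v) \<le> h v" for N
    proof -
      have "(\<Sum>n<N. f n v) \<le> (\<Sum>n. f n v)"
        by (rule sum_le_suminf) (use fsums[OF v] fpos in \<open>auto simp: sums_iff\<close>)
      thus ?thesis using fsums[OF v] fpos by (simp add: sums_iff sum_nonneg)
    qed
    show "(\<lambda>N. \<Sum>n<N. f n v) \<longlonglongrightarrow> h v" using fsums[OF v] by (simp add: sums_def)
  qed
  moreover have "integral {0<..} (\<lambda>v. \<Sum>n<N. f n v) = (\<Sum>n<N. 2 powr (- p/2 - 1) * c n)" for N
    using fint by (subst integral_sum) (auto simp: integrable_on_def intro!: sum.cong integral_unique)
  ultimately have "(\<lambda>n. 2 powr (- p/2 - 1) * c n) sums integral {0<..} h"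
    by (simp add: sums_def)
  hence "(\<lambda>n. 2 powr (p/2 + 1) * (2 powr (- p/2 - 1) * c n)) sums (2 powr (p/2 + 1) * integral {0<..} h)"
    by (rule sums_mult)
  moreover have e: "2 powr (p/2 + 1) * (2 powr (- p/2 - 1) * x) = x" for x :: real
  proof -
    have "2 powr (p/2 + 1) * 2 powr (- p/2 - 1) = (1::real)" by (subst powr_add[symmetric]) simp
    thus ?thesis by (simp add: mult.assoc[symmetric])
  qed
  ultimately have suminf: "(\<Sum>n. c n) = 2 powr (p/2 + 1) * integral {0<..} h"
    unfolding e by (simp only: sums_iff)
  have "Gamma (complex_of_real (p/2)) * Gamma (complex_of_real (1 - p/2)) = of_real pi / sin (of_real (pi * (p/2)))"
    using Gamma_reflection_complex[of "of_real (p/2)"] by (simp only: of_real_mult of_real_diff of_real_1)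
  hence "complex_of_real (Gamma (p/2) * Gamma (1 - p/2)) = complex_of_real (pi / sin (pi * (p/2)))"
    by (simp only: Gamma_complex_of_real sin_of_real of_real_mult[symmetric] of_real_divide[symmetric])
  hence "Gamma (p/2) * Gamma (1 - p/2) = pi / sin (pi * (p/2))"
    by (simp only: of_real_eq_iff)
  hence reflection: "Gamma (p/2) * Gamma (1 - p/2) = pi / sin (pi * p / 2)" by simp
  have sinpos: "sin (pi * p / 2) > 0" using p by (intro sin_gt_zero) auto
  have Gpos: "Gamma (p/2) > 0" "Gamma (1 - p/2) > 0" using p by (auto intro: Gamma_real_pos)
  have Gp: "Gamma (1 + p/2) = p/2 * Gamma (p/2)"
  proof -
    have "p/2 \<notin> \<int>\<^sub>\<le>\<^sub>0" using p nonpos_Ints_nonpos[of "p/2"] by linarith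
    thus ?thesis using Gamma_plus1[of "p/2"] by (simp add: add.commute)
  qed
  have "sin (pi * p / 2) * Gamma (1 + p/2) / pi * (\<Sum>n. c n) = 1"
    using eq unfolding c_def .
  hence "sin (pi * p / 2) * (p/2 * Gamma (p/2)) / pi * (2 powr (p/2 + 1) * integral {0<..} h) = 1"
    unfolding suminf Gp .
  hence "p/2 * (sin (pi * p / 2) * Gamma (p/2) / pi) * (2 powr (p/2 + 1) * integral {0<..} h) = 1"
    by (simp only: times_divide_eq_right times_divide_eq_left mult_ac)
  moreover have "sin (pi * p / 2) * Gamma (p/2) / pi = 1 / Gamma (1 - p/2)"
    using reflection sinpos Gpos by (simp add: field_simps)
  ultimately have "p/2 * (1 / Gamma (1 - p/2)) * (2 powr (p/2 + 1) * integral {0<..} h) = 1"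
    by (simp only:)
  hence "2 powr (p/2 + 1) * integral {0<..} h = 2 * Gamma (1 - p/2) / p"
    using p Gpos by (simp add: field_simps)
  hence "2 powr (-p/2-1) * (2 powr (p/2 + 1) * integral {0<..} h) = 2 powr (-p/2-1) * (2 * Gamma (1 - p/2) / p)"
    by simp
  hence "integral {0<..} h = 2 powr (-p/2-1) * (2 * Gamma (1 - p/2) / p)"
    using e[of "integral {0<..} h"] by (simp add: mult_ac)
  also have "2 powr (-p/2-1) = 2 powr (-p/2) / (2::real)" by (simp add: powr_diff)
  finally have "integral {0<..} h = 2 powr (-p/2) * Gamma (1 - p/2) / p" by simp
  moreover have "integral {0<..} h = integral {0<..} (barrier_integrand p 0) - integral {0<..} (barrier_integrand p K)"
    unfolding h_def by (intro integral_diff int)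
  ultimately show ?thesis using integral_barrier_integrand_0[OF p] by simp
qed

text \<open>
  As a function of \<open>v\<close> the integrand changes sign once, from negative to positive, at \<open>v = 2 * K\<close>.
  Passing from the exponent \<open>p\<close> to \<open>q < p\<close> multiplies it by \<open>v powr (p - q)\<close>, which gives relatively more
  weight to the positive part.
\<close>
lemma integral_barrier_integrand_pos:
  assumes pq: "0 < q" "q < p" "p < 1" and K: "K > 0"
    and zero: "integral {0<..} (barrier_integrand p K) = 0"
  shows "integral {0<..} (barrier_integrand q K) > 0"
proof -
  define D where "D = (\<lambda>v. barrier_integrand q K v - (2*K) powr (p - q) * barrier_integrand p K v)"
  have D: "D v = ((1 - exp (v * (K - v/2))) * (v powr (p - q) - (2*K) powr (p - q))) * v powr (-1-p)" if "v > 0" for v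
  proof -
    have "v powr (-1-q) = v powr (p - q) * v powr (-1-p)" by (subst powr_add[symmetric]) (simp add: algebra_simps)
    thus ?thesis unfolding D_def barrier_integrand_def by (simp add: algebra_simps power2_eq_square)
  qed
  have nonneg: "D v \<ge> 0" if "v > 0" for v
  proof (cases "v \<le> 2 * K")
    case True
    have "1 - exp (v * (K - v/2)) \<le> 0" "v powr (p - q) - (2*K) powr (p - q) \<le> 0"
      using True that pq by (auto intro!: powr_mono2)
    thus ?thesis unfolding D[OF that] by (intro mult_nonneg_nonneg mult_nonpos_nonpos) auto
  next
    case False
    have "1 - exp (v * (K - v/2)) \<ge> 0" "v powr (p - q) - (2*K) powr (p - q) \<ge> 0"
      using False that pq K by (auto intro!: powr_mono2 mult_nonneg_nonpos)
    thus ?thesis unfolding D[OF that] by (intro mult_nonneg_nonneg) auto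
  qed
  have pos: "D v > 0" if "v > 2 * K" for v
  proof -
    have v: "v > 0" using that K by linarith
    have "v * (K - v/2) < 0" using that v by (intro mult_pos_neg) auto
    hence "1 - exp (v * (K - v/2)) > 0" by simp
    moreover have "v powr (p - q) - (2*K) powr (p - q) > 0"
      using that K pq by (auto intro!: powr_less_mono2)
    ultimately show ?thesis unfolding D[OF v] using v by (intro mult_pos_pos) auto
  qed
  have int: "barrier_integrand p K integrable_on {0<..}" "barrier_integrand q K integrable_on {0<..}"
    using pq by (auto intro!: barrier_integrand_integrable_on)
  have Dint: "D integrable_on {0<..}" unfolding D_def
    by (intro integrable_diff integrable_on_mult_right int)
  have cont: "continuous_on {3*K..4*K} D"
    unfolding D_def barrier_integrand_def using K by (intro continuous_intros) auto
  have "0 = integral {3*K..4*K} (\<lambda>_. 0::real)" by simp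
  also have "\<dots> < integral {3*K..4*K} D"
    by (rule integral_less_real) (use K cont pos in auto)
  also have "\<dots> \<le> integral {0<..} D"
    by (rule integral_subset_le) (use K Dint nonneg cont in \<open>auto intro: integrable_continuous_interval\<close>)
  also have "integral {0<..} D = integral {0<..} (barrier_integrand q K)"
    unfolding D_def using int by (subst integral_diff) (auto simp: zero integral_mult_right intro: integrable_on_mult_right)
  finally show ?thesis .
qed

text \<open>
  Room for later perturbations: positivity survives cutting off large \<open>v\<close> and moving \<open>y\<close> slightly
  beyond \<open>K\<close>, uniformly. Raising the cutoff above \<open>2 * y\<close> only adds positive contributions.
\<close>
lemma truncated_barrier_integral_pos:
  assumes q: "0 < q" "q < 1" and K: "K > 0"
    and pos: "integral {0<..} (barrier_integrand q K) > 0"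
  shows "\<exists>g>0. \<exists>c. \<exists>K'>K. \<forall>\<Lambda>\<ge>c. \<forall>y\<le>K'. integral {0<..\<Lambda>} (barrier_integrand q y) \<ge> g"
proof -
  define G where "G = integral {0<..} (barrier_integrand q K)"
  define T where "T = (\<lambda>y \<Lambda>. integral {0<..\<Lambda>} (barrier_integrand q y))"
  have intq: "barrier_integrand q y integrable_on {0<..}" for y
    using q by (intro barrier_integrand_integrable_on) auto
  have T_int: "barrier_integrand q y integrable_on {0<..c}" for y c
    using q by (intro barrier_integrand_integrable_on) auto
  have T_eq: "T y c = integral {0<..} (\<lambda>v. if v \<in> {0<..c} then barrier_integrand q y v else 0)" for y c
    unfolding T_def Henstock_Kurzweil_Integration.integral_restrict_Int by (rule arg_cong[where f = "\<lambda>S. integral S _"]) auto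
  have restr: "(\<lambda>v. if v \<in> {0<..c} then barrier_integrand q y v else 0) integrable_on {0<..}" for y c
  proof -
    have "{0<..c} \<inter> {0<..} = {0<..c}" for c :: real by auto
    thus ?thesis unfolding Henstock_Kurzweil_Integration.integrable_restrict_Int by (simp add: T_int)
  qed
  have "(\<lambda>n. T K (real n)) \<longlonglongrightarrow> G"
    unfolding T_eq G_def
  proof (rule dominated_convergence[OF restr])
    show "(\<lambda>v. norm (barrier_integrand q K v)) integrable_on {0<..}"
      using absolutely_integrable_barrier_integrand[OF q] by (simp add: absolutely_integrable_on_def)
    fix v :: real assume v: "v \<in> {0<..}"
    have "eventually (\<lambda>n. real n \<ge> v) sequentially" by real_asymp
    hence "eventually (\<lambda>n. (if v \<in> {0<..real n} then barrier_integrand q K v else 0) = barrier_integrand q K v) sequentially"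
      by eventually_elim (use v in auto)
    thus "(\<lambda>n. if v \<in> {0<..real n} then barrier_integrand q K v else 0) \<longlonglongrightarrow> barrier_integrand q K v"
      by (rule tendsto_eventually)
  qed auto
  moreover have "G > G/2" using pos by (simp add: G_def)
  ultimately have "eventually (\<lambda>n. T K (real n) > G/2) sequentially" by (rule order_tendstoD)
  moreover have "eventually (\<lambda>n. real n \<ge> 2 * (K + 1)) sequentially" by real_asymp
  ultimately have "eventually (\<lambda>n. T K (real n) > G/2 \<and> real n \<ge> 2 * (K + 1)) sequentially"
    by (rule eventually_conj)
  then obtain n where n: "T K (real n) > G/2" "real n \<ge> 2 * (K + 1)"
    by (auto simp: eventually_sequentially)
  define c where "c = real n"
  have c: "c > 0" "T K c > G/2" "c \<ge> 2 * (K + 1)" using n K by (auto simp: c_def)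
  \<comment> \<open>Moving \<open>y\<close> from \<open>K\<close> to \<open>K + d\<close> lowers the integrand on the bounded domain by at most
    \<open>d * E * v powr (- q)\<close>, whose integral is at most \<open>d * E * J\<close>.\<close>
  define J where "J = c powr (1 - q) / (1 - q)"
  have J: "((\<lambda>v. v powr (-q)) has_integral J) {0<..c}"
  proof -
    have "((\<lambda>v. v powr (-q)) has_integral J) {0..c}"
      unfolding J_def using has_integral_powr_from_0[of "-q" c] q c by simp
    thus ?thesis
      by (subst has_integral_spike_set_eq[where T = "{0..c}"])
         (auto intro!: negligible_subset[of "{0::real}"] empty_imp_negligible)
  qed
  have Jpos: "J > 0" unfolding J_def using c q by auto
  define E where "E = exp (c * (K + 1))"
  define d where "d = min 1 (G / (4 * E * J))"
  have Epos: "E > 0" by (simp add: E_def)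
  have d: "d > 0" "d \<le> 1" "d * E * J \<le> G/4"
  proof -
    show "d > 0" using pos Jpos Epos by (simp add: d_def G_def)
    show "d \<le> 1" by (simp add: d_def)
    have "d * (E * J) \<le> G / (4 * E * J) * (E * J)"
      using Epos Jpos by (intro mult_right_mono) (auto simp: d_def)
    thus "d * E * J \<le> G/4" using Epos Jpos by (simp add: field_simps)
  qed
  have "T y \<Lambda> \<ge> G/4" if \<Lambda>: "\<Lambda> \<ge> c" and y: "y \<le> K + d" for y \<Lambda>
  proof -
    have "(\<lambda>v. barrier_integrand q K v - d * E * v powr (-q)) integrable_on {0<..c}"
      using J by (intro integrable_diff T_int integrable_on_mult_right) (auto simp: integrable_on_def)
    have "G/4 \<le> T K c - d * E * J" using c d by linarith
    also have "\<dots> = integral {0<..c} (\<lambda>v. barrier_integrand q K v - d * E * v powr (-q))"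
      unfolding T_def using J
      by (subst integral_diff) (auto simp: integral_mult_right integral_unique integrable_on_def T_int[unfolded integrable_on_def] intro!: has_integral_mult_right)
    also have "\<dots> \<le> integral {0<..c} (barrier_integrand q y)"
    proof (rule integral_le)
      fix v assume v: "v \<in> {0<..c}"
      have "exp (v * y) \<le> exp (v * (K + d))" using v y by (auto intro!: mult_left_mono)
      moreover have "exp (v * (K + d)) - exp (v * K) \<le> (v * d) * E"
      proof -
        have "1 + (- (v * d)) \<le> exp (- (v * d))" by (rule exp_ge_add_one_self)
        hence "(1 - v * d) * exp (v * (K + d)) \<le> exp (- (v * d)) * exp (v * (K + d))"
          by (intro mult_right_mono) auto
        also have "\<dots> = exp (v * K)" by (simp add: algebra_simps flip: exp_add)
        finally have "exp (v * (K + d)) - exp (v * K) \<le> (v * d) * exp (v * (K + d))" by (simp add: algebra_simps)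
        also have "v * (K + d) \<le> c * (K + 1)" using v K d by (intro mult_mono) auto
        hence "(v * d) * exp (v * (K + d)) \<le> (v * d) * E" unfolding E_def using v d by (intro mult_left_mono) auto
        finally show ?thesis .
      qed
      ultimately have 1: "exp (v * y) - exp (v * K) \<le> (v * d) * E" by linarith
      have ex: "exp (v * z - v\<^sup>2/2) = exp (v * z) * exp (- (v\<^sup>2/2))" for z by (simp flip: exp_add)
      have "exp (v * y - v\<^sup>2/2) - exp (v * K - v\<^sup>2/2) = (exp (v * y) - exp (v * K)) * exp (- (v\<^sup>2/2))"
        unfolding ex by (simp add: algebra_simps)
      also have "\<dots> \<le> ((v * d) * E) * exp (- (v\<^sup>2/2))" using 1 by (rule mult_right_mono) simp
      also have "\<dots> \<le> ((v * d) * E) * 1" using v d Epos by (intro mult_left_mono) auto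
      finally have "(1 - exp (v * K - v\<^sup>2/2)) - d * E * v \<le> 1 - exp (v * y - v\<^sup>2/2)" by (simp add: algebra_simps)
      hence "((1 - exp (v * K - v\<^sup>2/2)) - d * E * v) * v powr (-1-q) \<le> (1 - exp (v * y - v\<^sup>2/2)) * v powr (-1-q)"
        by (rule mult_right_mono) simp
      moreover have "v powr 1 * v powr (-1-q) = v powr (-q)" by (subst powr_add[symmetric]) simp
      ultimately show "barrier_integrand q K v - d * E * v powr (-q) \<le> barrier_integrand q y v"
        unfolding barrier_integrand_def using v by (simp add: algebra_simps)
    qed (fact | rule T_int)+
    also have "\<dots> = T y c" by (simp add: T_def)
    also have "\<dots> \<le> T y \<Lambda>" unfolding T_eq
    proof (rule integral_le[OF restr restr])
      fix v :: real assume v: "v \<in> {0<..}"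
      have "barrier_integrand q y v \<ge> 0" if "v > c"
      proof -
        have y1: "y \<le> K + 1" using y d(2) by linarith
        have v1: "K + 1 < v/2" using that c(3) by argo
        have "y - v/2 \<le> 0" using y1 v1 by linarith
        hence "v * (y - v/2) \<le> 0" using v by (intro mult_nonneg_nonpos) auto
        hence "v * y - v\<^sup>2/2 \<le> 0" by (simp add: algebra_simps power2_eq_square)
        thus ?thesis unfolding barrier_integrand_def by (intro mult_nonneg_nonneg) auto
      qed
      thus "(if v \<in> {0<..c} then barrier_integrand q y v else 0) \<le> (if v \<in> {0<..\<Lambda>} then barrier_integrand q y v else 0)"
        using v \<Lambda> by auto
    qed
    finally show ?thesis .
  qed
  hence "\<forall>\<Lambda>\<ge>c. \<forall>y\<le>K + d. integral {0<..\<Lambda>} (barrier_integrand q y) \<ge> G/4"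
    unfolding T_def by blast
  moreover have "G/4 > 0" "K + d > K" using pos d by (auto simp: G_def)
  ultimately show ?thesis by blast
qed

section \<open>A supermartingale that is large below the barrier\<close>

text \<open>
  The function \<open>h\<close> with Brownian motion's exponent \<open>l\<^sup>2 / 2\<close> replaced by \<open>a * l\<^sup>2 - b * l\<close>, where \<open>a\<close> is
  slightly less than \<open>1/2\<close> to pay for the discreteness of the walk and \<open>b\<close> pays for its drift. The
  cutoff \<open>c\<close> is there because the exponent is below that of the walk only for small \<open>l\<close>.
\<close>
definition barrier_function :: "real \<Rightarrow> real \<Rightarrow> real \<Rightarrow> real \<Rightarrow> real \<Rightarrow> real \<Rightarrow> real" where
  "barrier_function q a b c t x =
     integral {0<..c} (\<lambda>l. (1 - exp (l * x - (a * l\<^sup>2 - b * l) * t)) * l powr (-1 - q))"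

lemma barrier_function_integrable:
  fixes x a b c t q :: real
  assumes "q < 1" "c \<ge> 0"
  shows "(\<lambda>l. (1 - exp (l * x - (a * l\<^sup>2 - b * l) * t)) * l powr (-1 - q)) integrable_on {0<..c}"
proof (intro set_lebesgue_integral_eq_integral(1) absolutely_integrable_one_minus_exp[where C = "\<bar>x\<bar> + (\<bar>a\<bar> * c + \<bar>b\<bar>) * \<bar>t\<bar>"])
  fix l :: real assume l: "0 < l" "l \<le> c"
  have "\<bar>l * x - (a * l\<^sup>2 - b * l) * t\<bar> = \<bar>l * (x - (a * l - b) * t)\<bar>"
    by (simp add: algebra_simps power2_eq_square)
  also have "\<dots> = \<bar>x - (a * l - b) * t\<bar> * l" using l by (simp add: abs_mult)
  also have "\<dots> \<le> (\<bar>x\<bar> + (\<bar>a\<bar> * c + \<bar>b\<bar>) * \<bar>t\<bar>) * l"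
  proof (rule mult_right_mono)
    have "\<bar>a * l - b\<bar> \<le> \<bar>a * l\<bar> + \<bar>b\<bar>" by linarith
    also have "\<bar>a * l\<bar> \<le> \<bar>a\<bar> * c" using l by (simp add: abs_mult mult_left_mono)
    finally have "\<bar>a * l - b\<bar> * \<bar>t\<bar> \<le> (\<bar>a\<bar> * c + \<bar>b\<bar>) * \<bar>t\<bar>" by (intro mult_right_mono) auto
    thus "\<bar>x - (a * l - b) * t\<bar> \<le> \<bar>x\<bar> + (\<bar>a\<bar> * c + \<bar>b\<bar>) * \<bar>t\<bar>" by (simp flip: abs_mult)
  qed (use l in auto)
  finally show "\<bar>l * x - (a * l\<^sup>2 - b * l) * t\<bar> \<le> (\<bar>x\<bar> + (\<bar>a\<bar> * c + \<bar>b\<bar>) * \<bar>t\<bar>) * l" .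
qed (use assms in \<open>auto intro!: continuous_intros\<close>)

lemma barrier_function_mono:
  assumes "q < 1" "c \<ge> 0"
    and "\<And>l. 0 < l \<Longrightarrow> l \<le> c \<Longrightarrow> l * x' - (a' * l\<^sup>2 - b' * l) * t' \<le> l * x - (a * l\<^sup>2 - b * l) * t"
  shows "barrier_function q a b c t x \<le> barrier_function q a' b' c t' x'"
  unfolding barrier_function_def
  by (intro integral_le barrier_function_integrable assms(1,2) mult_right_mono) (use assms(3) in auto)

text \<open>
  If each \<open>exp (l * x - (a * l\<^sup>2 - b * l) * t)\<close> is a submartingale along a walk that steps up with
  probability \<open>\<alpha>\<close>, then one minus it is a supermartingale, and so is any mixture with positive weights.
\<close>
lemma barrier_function_step:
  assumes q: "q < 1" "c \<ge> 0"
    and step: "\<And>l. 0 < l \<Longrightarrow> l \<le> c \<Longrightarrow> exp (a * l\<^sup>2 - b * l) \<le> \<alpha> * exp l + (1 - \<alpha>) * exp (- l)"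
  shows "\<alpha> * barrier_function q a b c (t + 1) (x + 1) + (1 - \<alpha>) * barrier_function q a b c (t + 1) (x - 1)
           \<le> barrier_function q a b c t x"
proof -
  note int = barrier_function_integrable[OF q]
  have "\<alpha> * barrier_function q a b c (t + 1) (x + 1) + (1 - \<alpha>) * barrier_function q a b c (t + 1) (x - 1)
     = integral {0<..c} (\<lambda>l. \<alpha> * ((1 - exp (l * (x + 1) - (a * l\<^sup>2 - b * l) * (t + 1))) * l powr (-1 - q))
         + (1 - \<alpha>) * ((1 - exp (l * (x - 1) - (a * l\<^sup>2 - b * l) * (t + 1))) * l powr (-1 - q)))"
    unfolding barrier_function_def
    by (subst integral_add) (auto intro!: integrable_on_mult_right int simp: integral_mult_right)
  also have "\<dots> \<le> barrier_function q a b c t x"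
    unfolding barrier_function_def
  proof (intro integral_le integrable_add integrable_on_mult_right int)
    fix l assume l: "l \<in> {0<..c}"
    define u where "u = a * l\<^sup>2 - b * l"
    define e where "e = exp (l * x - u * t)"
    define E where "E = e * exp (-u)"
    have e1: "exp (l * (x + 1) - u * (t + 1)) = E * exp l"
      unfolding E_def e_def by (simp add: algebra_simps flip: exp_add)
    have e2: "exp (l * (x - 1) - u * (t + 1)) = E * exp (-l)"
      unfolding E_def e_def by (simp add: algebra_simps flip: exp_add)
    have "exp u \<le> \<alpha> * exp l + (1 - \<alpha>) * exp (- l)" using step[of l] l by (simp add: u_def)
    hence "E * exp u \<le> E * (\<alpha> * exp l + (1 - \<alpha>) * exp (- l))"
      by (intro mult_left_mono) (auto simp: e_def E_def)
    moreover have "E * exp u = e" unfolding E_def by (simp add: mult.assoc flip: exp_add)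
    ultimately have "\<alpha> * (1 - E * exp l) + (1 - \<alpha>) * (1 - E * exp (-l)) \<le> 1 - e"
      by (simp add: algebra_simps)
    hence "(\<alpha> * (1 - E * exp l) + (1 - \<alpha>) * (1 - E * exp (-l))) * l powr (-1-q) \<le> (1 - e) * l powr (-1-q)"
      by (rule mult_right_mono) simp
    thus "\<alpha> * ((1 - exp (l * (x + 1) - (a * l\<^sup>2 - b * l) * (t + 1))) * l powr (-1 - q))
         + (1 - \<alpha>) * ((1 - exp (l * (x - 1) - (a * l\<^sup>2 - b * l) * (t + 1))) * l powr (-1 - q))
         \<le> (1 - exp (l * x - (a * l\<^sup>2 - b * l) * t)) * l powr (-1 - q)"
      unfolding u_def[symmetric] e1 e2 e_def[symmetric] by (simp add: algebra_simps)
  qed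
  finally show ?thesis .
qed

text \<open>
  Diffusive scaling, by the substitution \<open>v = s * l\<close>: this reduces bounds for all large times to the
  bound for the truncated integral.
\<close>
lemma barrier_function_scaling:
  assumes q: "0 < q" "q < 1" and c: "c \<ge> 0" and s: "s > 0" "s\<^sup>2 = 2 * a * t"
  shows "barrier_function q a b c t x = s powr q * integral {0<..s * c} (barrier_integrand q ((x + b * t) / s))"
proof -
  let ?y = "(x + b * t) / s"
  have img: "(\<lambda>l. s * l) ` {0<..c} = {0<..s * c}"
  proof (intro equalityI subsetI)
    fix v assume "v \<in> {0<..s * c}"
    thus "v \<in> (\<lambda>l. s * l) ` {0<..c}" using s by (intro image_eqI[of _ _ "v / s"]) (auto simp: field_simps)
  qed (use s in auto)
  have abs: "barrier_integrand q ?y absolutely_integrable_on {0<..s * c}"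
    by (rule set_integrable_subset[OF absolutely_integrable_barrier_integrand[OF q]]) auto
  have "(\<lambda>l. \<bar>s\<bar> * barrier_integrand q ?y (s * l)) absolutely_integrable_on {0<..c} \<and>
     integral {0<..c} (\<lambda>l. \<bar>s\<bar> * barrier_integrand q ?y (s * l)) = integral {0<..s * c} (barrier_integrand q ?y)"
    by (subst has_absolute_integral_change_of_variables_1'[where g = "\<lambda>l. s * l"])
       (use s abs img in \<open>auto intro!: derivative_eq_intros inj_onI\<close>)
  hence "integral {0<..s * c} (barrier_integrand q ?y) = integral {0<..c} (\<lambda>l. \<bar>s\<bar> * barrier_integrand q ?y (s * l))"
    by simp
  hence "s powr q * integral {0<..s * c} (barrier_integrand q ?y) = integral {0<..c} (\<lambda>l. s powr q * (\<bar>s\<bar> * barrier_integrand q ?y (s * l)))"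
    by (simp only: integral_mult_right)
  also have "\<dots> = barrier_function q a b c t x"
    unfolding barrier_function_def
  proof (rule integral_cong)
    fix l assume l: "l \<in> {0<..c}"
    have 1: "(s * l) * ?y - (s * l)\<^sup>2 / 2 = l * x - (a * l\<^sup>2 - b * l) * t"
    proof -
      have "(s * l) * ?y = l * (x + b * t)" using s by simp
      thus ?thesis using s by (simp add: power_mult_distrib algebra_simps)
    qed
    have "(s * l) powr (-1 - q) = s powr (-1-q) * l powr (-1-q)" using s l by (simp add: powr_mult)
    moreover have "s powr q * (s * s powr (-1-q)) = 1"
    proof -
      have "s powr q * (s powr 1 * s powr (-1-q)) = s powr (q + (1 + (-1-q)))" by (simp only: powr_add)
      thus ?thesis using s by simp
    qed
    ultimately have 2: "s powr q * (s * (s * l) powr (-1 - q)) = l powr (-1-q)"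
      by (simp add: mult.assoc[symmetric])
    have "s powr q * (\<bar>s\<bar> * barrier_integrand q ?y (s * l)) =
       (1 - exp ((s * l) * ?y - (s * l)\<^sup>2 / 2)) * (s powr q * (s * (s * l) powr (-1 - q)))"
      using s unfolding barrier_integrand_def by (simp only: abs_of_pos mult_ac)
    thus "s powr q * (\<bar>s\<bar> * barrier_integrand q ?y (s * l)) = (1 - exp (l * x - (a * l\<^sup>2 - b * l) * t)) * l powr (-1 - q)"
      unfolding 1 2 .
  qed
  finally show ?thesis ..
qed

lemma cosh_lower_bound: "1 + x\<^sup>2 / 2 \<le> cosh x" for x :: real
proof -
  have s: "(\<lambda>n. if even n then x ^ n /\<^sub>R fact n else 0) sums cosh x" by (rule cosh_converges)
  have "(\<Sum>n<3. if even n then x ^ n /\<^sub>R fact n else 0) \<le> (\<Sum>n. if even n then x ^ n /\<^sub>R fact n else 0)"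
    by (rule sum_le_suminf) (use s in \<open>auto simp: sums_iff zero_le_even_power\<close>)
  thus ?thesis using s by (simp add: sums_iff eval_nat_numeral field_simps)
qed

text \<open>
  A step of the biased walk has exponential moment at least \<open>cosh l - \<delta> * sinh l\<close>. Here \<open>cosh l\<close>
  beats \<open>exp (a * l\<^sup>2)\<close> for small \<open>l\<close> because \<open>a < 1/2\<close>, and since \<open>sinh l \<le> 2 * l * cosh l\<close> the drift costs
  at most the factor \<open>1 - 2 * \<delta> * l\<close>.
\<close>
lemma biased_step_exponential_bound:
  fixes l a \<alpha> \<delta> :: real
  assumes l: "0 < l" "l \<le> 1" and a: "l\<^sup>2 / 4 \<le> 1/2 - a" and \<delta>: "0 \<le> \<delta>" "\<delta> \<le> 1/4"
    and \<alpha>: "(1 - \<delta>) / 2 \<le> \<alpha>"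
  shows "exp (a * l\<^sup>2 - 4 * \<delta> * l) \<le> \<alpha> * exp l + (1 - \<alpha>) * exp (- l)"
proof -
  have "exp (a * l\<^sup>2) \<le> 1 + l\<^sup>2 / 2"
  proof -
    have l2: "l\<^sup>2 \<le> 1" using l by (simp add: power_le_one)
    have "l\<^sup>2/2 - (l\<^sup>2/2)\<^sup>2 \<le> ln (1 + l\<^sup>2/2)"
      by (rule ln_one_plus_pos_lower_bound) (use l2 in auto)
    moreover have "l\<^sup>2 * (l\<^sup>2 / 4) \<le> l\<^sup>2 * (1/2 - a)" using a by (rule mult_left_mono) simp
    ultimately have "a * l\<^sup>2 \<le> ln (1 + l\<^sup>2/2)" by (simp add: power2_eq_square algebra_simps)
    hence "exp (a * l\<^sup>2) \<le> exp (ln (1 + l\<^sup>2/2))" by simp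
    also have "\<dots> = 1 + l\<^sup>2/2" by (rule exp_ln) (use zero_le_power2[of l] in linarith)
    finally show ?thesis .
  qed
  also have "\<dots> \<le> cosh l" by (rule cosh_lower_bound)
  finally have 1: "exp (a * l\<^sup>2) \<le> cosh l" .
  have 2: "exp (- (4 * \<delta> * l)) \<le> 1 - 2 * \<delta> * l"
  proof -
    define u where "u = 2 * \<delta> * l"
    have u: "0 \<le> u" "u \<le> 1/2"
      using l \<delta> mult_mono[of "2 * \<delta>" "1/2" l 1] by (auto simp: u_def)
    have "- u - 2 * u\<^sup>2 \<le> ln (1 - u)" by (rule ln_one_minus_pos_lower_bound[OF u])
    moreover have "u * u \<le> u * (1/2)" using u by (intro mult_left_mono) auto
    ultimately have "- (2 * u) \<le> ln (1 - u)" by (simp add: power2_eq_square)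
    hence "exp (- (2 * u)) \<le> exp (ln (1 - u))" by simp
    also have "\<dots> = 1 - u" using u by (intro exp_ln) auto
    finally show ?thesis by (simp add: u_def mult_ac)
  qed
  have 3: "sinh l \<le> 2 * l * cosh l"
  proof -
    have "1 + (- 2 * l) \<le> exp (- 2 * l)" by (rule exp_ge_add_one_self)
    hence "(1 - 2 * l) * exp l \<le> exp (- 2 * l) * exp l" by (intro mult_right_mono) auto
    also have "\<dots> = exp (- l)" by (simp flip: exp_add)
    finally have "exp l - exp (- l) \<le> 2 * l * exp l" by (simp add: algebra_simps)
    also have "\<dots> \<le> 2 * l * (exp l + exp (-l))" using l by (intro mult_left_mono) auto
    finally show ?thesis by (simp add: sinh_def cosh_def)
  qed
  have "exp (a * l\<^sup>2 - 4 * \<delta> * l) = exp (a * l\<^sup>2) * exp (- (4 * \<delta> * l))" by (simp flip: exp_add)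
  also have "\<dots> \<le> cosh l * (1 - 2 * \<delta> * l)" using 1 2 by (intro mult_mono) auto
  also have "\<dots> = cosh l - \<delta> * (2 * l * cosh l)" by (simp add: algebra_simps)
  also have "\<dots> \<le> cosh l - \<delta> * sinh l" using mult_left_mono[OF 3 \<delta>(1)] by linarith
  also have "\<dots> = exp (-l) + (1 - \<delta>) / 2 * (exp l - exp (-l))" by (simp add: sinh_def cosh_def field_simps)
  also have "\<dots> \<le> exp (-l) + \<alpha> * (exp l - exp (-l))"
    using l by (intro add_left_mono mult_right_mono \<alpha>) auto
  also have "\<dots> = \<alpha> * exp l + (1 - \<alpha>) * exp (- l)" by (simp add: algebra_simps)
  finally show ?thesis .
qed

text \<open>
  The time horizon is \<open>m\<^sup>2\<close>. A drift of order \<open>\<epsilon> / m\<close> moves the walk by at most \<open>\<epsilon> * sqrt t\<close> up to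
  any time \<open>t \<le> m\<^sup>2\<close>, which for small \<open>\<epsilon>\<close> fits into the gap between \<open>K\<close> and the larger \<open>K'\<close> for which the
  truncated integral is still positive; for \<open>t \<ge> t0\<close> so does \<open>j + 1\<close>. The extra \<open>1\<close> is the
  overshoot of a walk that leaves the allowed region by a single step. The constants do not depend
  on \<open>m\<close>, which is what turns the bound into a power of \<open>m\<close>.
\<close>
lemma barrier_supermartingale:
  assumes isp: "is_p K p" and K: "K > 0" and q: "0 < q" "q < p" and j: "j \<ge> 0"
  shows "\<exists>\<epsilon>>0. \<exists>t0 c C. c > 0 \<and> (\<forall>m \<delta>. 0 < m \<longrightarrow> 0 \<le> \<delta> \<longrightarrow> \<delta> \<le> \<epsilon> / real m \<longrightarrow>
    (\<exists>F :: nat \<Rightarrow> real \<Rightarrow> real.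
       (\<forall>t. antimono (F t)) \<and>
       (\<forall>t x \<alpha>. (1 - \<delta>) / 2 \<le> \<alpha> \<longrightarrow> \<alpha> * F (Suc t) (x + 1) + (1 - \<alpha>) * F (Suc t) (x - 1) \<le> F t x) \<and>
       (\<forall>t x. t0 \<le> t \<longrightarrow> t \<le> m\<^sup>2 \<longrightarrow> x \<le> j + 1 + K * sqrt (real t) \<longrightarrow> c * sqrt (real t) powr q \<le> F t x) \<and>
       (\<forall>t. F t (- real t) \<le> C t)))"
proof -
  have p: "0 < p" "p < 1" using isp by (auto simp: is_p_def)
  have q1: "q < 1" using q p by simp
  obtain g \<Lambda> K' where g: "g > 0" "K' > K"
    and trunc: "\<And>c y. c \<ge> \<Lambda> \<Longrightarrow> y \<le> K' \<Longrightarrow> integral {0<..c} (barrier_integrand q y) \<ge> g"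
    using truncated_barrier_integral_pos[OF q(1) q1 K integral_barrier_integrand_pos[OF q p(2) K integral_barrier_integrand_eq_0[OF isp K]]]
    by metis
  have K': "K' > 0" using g K by simp
  \<comment> \<open>\<open>r\<close> is the midpoint of \<open>K / K'\<close> and \<open>1\<close>. The scaling factor at time \<open>t\<close> is \<open>r * sqrt t\<close>, so
    that the barrier \<open>K * sqrt t\<close> corresponds to the argument \<open>K / r < K'\<close>.\<close>
  define r where "r = (1 + K / K') / 2"
  have r: "0 < r" "r < 1" "K < K' * r" using K K' g by (auto simp: r_def field_simps)
  define a where "a = r\<^sup>2 / 2"
  have r2: "r\<^sup>2 < 1" using r by (simp add: power_less_one_iff)
  have a: "a < 1/2" using r2 by (simp add: a_def)
  define l0 where "l0 = min 1 (1/2 - a)"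
  have l0: "0 < l0" "l0 \<le> 1" using a by (auto simp: l0_def)
  have l0a: "l\<^sup>2 / 4 \<le> 1/2 - a" if "0 < l" "l \<le> l0" for l
  proof -
    have "l * l \<le> 1 * l" using that l0 by (intro mult_right_mono) auto
    moreover have "l \<le> 1/2 - a" using that by (simp add: l0_def)
    ultimately show ?thesis using a unfolding power2_eq_square by linarith
  qed
  \<comment> \<open>The slack \<open>\<sigma> * sqrt t\<close> is shared equally by the drift (through \<open>\<epsilon>\<close>) and by \<open>j + 1\<close>
    (through \<open>B\<close>).\<close>
  define \<sigma> where "\<sigma> = K' * r - K"
  have \<sigma>: "\<sigma> > 0" using r by (simp add: \<sigma>_def)
  define \<epsilon> where "\<epsilon> = min (1/4) (\<sigma> / 8)"
  have \<epsilon>: "\<epsilon> > 0" "\<epsilon> \<le> 1/4" "4 * \<epsilon> \<le> \<sigma> / 2" using \<sigma> by (auto simp: \<epsilon>_def)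
  define B where "B = max 1 (max (2 * (j + 1) / \<sigma>) (\<Lambda> / (l0 * r)))"
  define t0 where "t0 = nat \<lceil>B\<^sup>2\<rceil>"
  define c where "c = r powr q * g"
  \<comment> \<open>Without the drift term the barrier function is larger, which gives a bound that is
    independent of \<open>\<delta>\<close>.\<close>
  define C where "C = (\<lambda>t. barrier_function q a 0 l0 (real t) (- real t))"
  have t0: "sqrt (real t) \<ge> B" if "t \<ge> t0" for t
  proof -
    have "B\<^sup>2 \<le> real t0" unfolding t0_def by linarith
    also have "\<dots> \<le> real t" using that by simp
    finally show ?thesis by (rule real_le_rsqrt)
  qed
  have main: "\<exists>F :: nat \<Rightarrow> real \<Rightarrow> real.
       (\<forall>t. antimono (F t)) \<and>
       (\<forall>t x \<alpha>. (1 - \<delta>) / 2 \<le> \<alpha> \<longrightarrow> \<alpha> * F (Suc t) (x + 1) + (1 - \<alpha>) * F (Suc t) (x - 1) \<le> F t x) \<and>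
       (\<forall>t x. t0 \<le> t \<longrightarrow> t \<le> m\<^sup>2 \<longrightarrow> x \<le> j + 1 + K * sqrt (real t) \<longrightarrow> c * sqrt (real t) powr q \<le> F t x) \<and>
       (\<forall>t. F t (- real t) \<le> C t)"
    if m: "0 < m" and \<delta>: "0 \<le> \<delta>" "\<delta> \<le> \<epsilon> / real m" for m \<delta>
  proof -
    have "\<epsilon> / real m \<le> \<epsilon>" using m \<epsilon> by (simp add: field_simps)
    hence \<delta>4: "\<delta> \<le> 1/4" using \<delta> \<epsilon> by linarith
    define F where "F = (\<lambda>(t::nat) x. barrier_function q a (4 * \<delta>) l0 (real t) x)"
    have "antimono (F t)" for t
      unfolding F_def by (intro antimonoI barrier_function_mono) (use q1 l0 in \<open>auto intro: mult_left_mono\<close>)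
    moreover have "\<alpha> * F (Suc t) (x + 1) + (1 - \<alpha>) * F (Suc t) (x - 1) \<le> F t x" if "(1 - \<delta>) / 2 \<le> \<alpha>" for t x \<alpha>
      using barrier_function_step[of q l0 a "4 * \<delta>" \<alpha> "real t" x]
        biased_step_exponential_bound[of _ a \<delta> \<alpha>] q1 l0 \<delta> \<delta>4 that l0a
      by (simp add: F_def add.commute)
    moreover have "c * sqrt (real t) powr q \<le> F t x"
      if t: "t0 \<le> t" "t \<le> m\<^sup>2" and x: "x \<le> j + 1 + K * sqrt (real t)" for t x
    proof -
      define w where "w = sqrt (real t)"
      have wB: "w \<ge> B" using t0[OF t(1)] by (simp add: w_def)
      hence w: "w \<ge> 1" "w \<ge> 2 * (j + 1) / \<sigma>" "w \<ge> \<Lambda> / (l0 * r)" by (auto simp: B_def)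
      have w2: "w\<^sup>2 = real t" by (simp add: w_def)
      have "real t \<le> (real m)\<^sup>2" using t(2) by (metis of_nat_le_iff of_nat_power)
      hence wm: "w \<le> real m" unfolding w_def by (intro real_le_lsqrt) auto
      have eq: "F t x = (r * w) powr q * integral {0<..r * w * l0} (barrier_integrand q ((x + 4 * \<delta> * real t) / (r * w)))"
        unfolding F_def by (rule barrier_function_scaling)
          (use q q1 l0 r w w2 in \<open>auto simp: a_def power_mult_distrib\<close>)
      have "\<delta> * real t \<le> \<epsilon> * w"
      proof -
        have "\<delta> * real t \<le> \<epsilon> / real m * real t" using \<delta> by (intro mult_right_mono) auto
        also have "\<dots> = \<epsilon> * w * (w / real m)" using w2 by (simp add: power2_eq_square)
        also have "\<dots> \<le> \<epsilon> * w * 1" using wm m \<epsilon> w by (intro mult_left_mono) auto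
        finally show ?thesis by simp
      qed
      hence "x + 4 * \<delta> * real t \<le> j + 1 + K * w + 4 * \<epsilon> * w" using x by (simp add: w_def)
      also have "j + 1 \<le> w * (\<sigma> / 2)" using w(2) \<sigma> by (simp add: field_simps)
      also have "4 * \<epsilon> * w \<le> \<sigma> / 2 * w" using \<epsilon> w by (intro mult_right_mono) auto
      finally have "x + 4 * \<delta> * real t \<le> K' * (r * w)" by (simp add: \<sigma>_def algebra_simps)
      hence "(x + 4 * \<delta> * real t) / (r * w) \<le> K'" using r w by (simp add: pos_divide_le_eq)
      moreover have "r * w * l0 \<ge> \<Lambda>" using w(3) r l0 by (simp add: field_simps)
      ultimately have "g \<le> integral {0<..r * w * l0} (barrier_integrand q ((x + 4 * \<delta> * real t) / (r * w)))"
        by (intro trunc)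
      hence "(r * w) powr q * g \<le> F t x" unfolding eq by (intro mult_left_mono) auto
      thus ?thesis using r w by (simp add: c_def w_def powr_mult mult_ac)
    qed
    moreover have "F t (- real t) \<le> C t" for t
      unfolding F_def C_def by (rule barrier_function_mono) (use q1 l0 \<delta> in \<open>auto simp: algebra_simps intro!: mult_nonneg_nonneg\<close>)
    ultimately show ?thesis by blast
  qed
  have "c > 0" unfolding c_def using r g by simp
  with main \<epsilon>(1) show ?thesis by blast
qed

section \<open>Two ordered walks in a field of three-valued states\<close>

text \<open>
  The argument is the state of a site during a short dynamical interval: its arrow if the arrow is
  known to be constant, and \<open>0\<close> if the clock may ring. An unknown arrow is chosen in favour of the walk.
\<close>
definition upper_arrow :: "int \<Rightarrow> int" where "upper_arrow y = (if y = -1 then -1 else 1)"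
definition lower_arrow :: "int \<Rightarrow> int" where "lower_arrow y = (if y = 1 then 1 else -1)"

lemma walk_range:
  assumes "\<And>z. z \<in> even_lattice \<Longrightarrow> \<eta> z \<in> {-1, 1}"
  shows "(walk \<eta> t, int t) \<in> even_lattice \<and> \<bar>walk \<eta> t\<bar> \<le> int t"
proof (induction t)
  case (Suc t)
  have "\<eta> (walk \<eta> t, int t) \<in> {-1, 1}" using assms Suc by blast
  thus ?case using Suc by (auto simp: even_lattice_def)
qed (auto simp: even_lattice_def)

text \<open>
  Both walks sit at sites of the same parity. So they either meet, and then the order of the arrows
  at the common site decides, or they are at least \<open>2\<close> apart and cannot pass in one step.
\<close>
lemma walk_mono:
  assumes \<eta>: "\<And>z. z \<in> even_lattice \<Longrightarrow> \<eta> z \<in> {-1, 1}" and \<eta>': "\<And>z. z \<in> even_lattice \<Longrightarrow> \<eta>' z \<in> {-1, 1}"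
    and le: "\<And>z. z \<in> even_lattice \<Longrightarrow> \<eta> z \<le> \<eta>' z"
  shows "walk \<eta> t \<le> walk \<eta>' t"
proof (induction t)
  case (Suc t)
  have w: "(walk \<eta> t, int t) \<in> even_lattice" "(walk \<eta>' t, int t) \<in> even_lattice"
    using walk_range[of \<eta> t] walk_range[of \<eta>' t] \<eta> \<eta>' by auto
  show ?case
  proof (cases "walk \<eta> t = walk \<eta>' t")
    case True
    thus ?thesis using le[OF w(1)] by simp
  next
    case False
    hence lt: "walk \<eta> t < walk \<eta>' t" using Suc by simp
    have "even (walk \<eta>' t - walk \<eta> t)" using w by (auto simp: even_lattice_def)
    then obtain k where "walk \<eta>' t - walk \<eta> t = 2 * k" by (rule evenE)
    hence "walk \<eta> t + 2 \<le> walk \<eta>' t" using lt by presburger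
    thus ?thesis using \<eta>[OF w(1)] \<eta>'[OF w(2)] by auto
  qed
qed simp

text \<open>
  The position at time \<open>t\<close> depends on the arrows at earlier levels only, whence its independence
  of the arrows at level \<open>t\<close>.
\<close>
lemma walk_cong:
  assumes \<eta>: "\<And>z. z \<in> even_lattice \<Longrightarrow> \<eta> z \<in> {-1, 1}"
    and eq: "\<And>z. z \<in> even_lattice \<Longrightarrow> snd z < int t \<Longrightarrow> \<eta> z = \<eta>' z"
  shows "walk \<eta> t = walk \<eta>' t"
  using eq
proof (induction t)
  case (Suc t)
  have IH: "walk \<eta> t = walk \<eta>' t" by (rule Suc.IH) (use Suc.prems in auto)
  have "(walk \<eta> t, int t) \<in> even_lattice" using walk_range[of \<eta> t, OF \<eta>] by blast
  hence "\<eta> (walk \<eta> t, int t) = \<eta>' (walk \<eta> t, int t)" by (rule Suc.prems) simp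
  thus ?case using IH by simp
qed simp

lemma measurable_countable_binary:
  fixes f :: "'a \<Rightarrow> 'b :: countable" and g :: "'a \<Rightarrow> 'c :: countable" and h :: "'b \<Rightarrow> 'c \<Rightarrow> 'd"
  assumes f: "f \<in> measurable N (count_space UNIV)" and g: "g \<in> measurable N (count_space UNIV)"
    and h: "\<And>x y. h x y \<in> space L"
  shows "(\<lambda>\<omega>. h (f \<omega>) (g \<omega>)) \<in> measurable N L"
proof (rule measurable_compose_countable[OF _ f])
  fix i
  show "(\<lambda>\<omega>. h i (g \<omega>)) \<in> measurable N L"
    by (rule measurable_compose[OF g]) (use h in auto)
qed

lemma walk_measurable:
  assumes "\<And>z. (\<lambda>\<omega>. \<eta> z \<omega>) \<in> measurable N (count_space UNIV)"
  shows "(\<lambda>\<omega>. walk (\<lambda>z. \<eta> z \<omega>) t) \<in> measurable N (count_space UNIV)"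
proof (induction t)
  case (Suc t)
  have "(\<lambda>\<omega>. \<eta> (walk (\<lambda>z. \<eta> z \<omega>) t, int t) \<omega>) \<in> measurable N (count_space UNIV)"
    by (rule measurable_compose_countable[OF _ Suc]) (rule assms)
  from measurable_countable_binary[OF Suc this, of "(+)"] show ?case by simp
qed simp

text \<open>
  The states of the sites during one short dynamical interval; \<open>\<delta>\<close> bounds the probability of an
  unknown arrow, and with it the drift of the two walks below.
\<close>
locale three_valued_field = prob_space M for M :: "'w measure" +
  fixes Y :: "int \<times> int \<Rightarrow> 'w \<Rightarrow> int" and \<delta> :: real
  assumes Y_measurable [measurable]: "\<And>z. Y z \<in> measurable M (count_space UNIV)"
    and Y_values: "\<And>z \<omega>. Y z \<omega> \<in> {-1, 0, 1}"
    and Y_indep: "indep_vars (\<lambda>_. count_space UNIV) Y even_lattice"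
    and Y_symmetric: "\<And>z. z \<in> even_lattice \<Longrightarrow> prob {\<omega> \<in> space M. Y z \<omega> = -1} = prob {\<omega> \<in> space M. Y z \<omega> = 1}"
    and Y_weight: "\<And>z. z \<in> even_lattice \<Longrightarrow> (1 - \<delta>) / 2 \<le> prob {\<omega> \<in> space M. Y z \<omega> = 1}"
begin

lemma integrable_finite_range:
  fixes \<phi> :: "'w \<Rightarrow> real"
  assumes "\<phi> \<in> borel_measurable M" "finite (\<phi> ` space M)"
  shows "integrable M \<phi>"
proof (rule integrable_const_bound)
  show "AE \<omega> in M. norm (\<phi> \<omega>) \<le> Max (norm ` (\<phi> ` space M))"
    by (rule AE_I2) (use assms(2) in \<open>auto intro!: Max_ge\<close>)
qed fact

lemma finite_range_Y: "finite ((\<lambda>\<omega>. \<phi> (Y z \<omega>) (Y z' \<omega>)) ` space M)"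
proof (rule finite_subset)
  show "(\<lambda>\<omega>. \<phi> (Y z \<omega>) (Y z' \<omega>)) ` space M \<subseteq> case_prod \<phi> ` ({-1, 0, 1} \<times> {-1, 0, 1})"
  proof
    fix r assume "r \<in> (\<lambda>\<omega>. \<phi> (Y z \<omega>) (Y z' \<omega>)) ` space M"
    then obtain \<omega> where "r = \<phi> (Y z \<omega>) (Y z' \<omega>)" by blast
    hence "r = case_prod \<phi> (Y z \<omega>, Y z' \<omega>)" by simp
    moreover have "(Y z \<omega>, Y z' \<omega>) \<in> {-1, 0, 1} \<times> {-1, 0, 1}" by (intro SigmaI Y_values)
    ultimately show "r \<in> case_prod \<phi> ` ({-1, 0, 1} \<times> {-1, 0, 1})" by (rule image_eqI)
  qed
qed auto

lemma expectation_Y: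
  fixes \<phi> :: "int \<Rightarrow> real"
  assumes z: "z \<in> even_lattice"
  defines "\<alpha> \<equiv> prob {\<omega> \<in> space M. Y z \<omega> = 1}"
  shows "expectation (\<lambda>\<omega>. \<phi> (Y z \<omega>)) = \<alpha> * \<phi> 1 + \<alpha> * \<phi> (-1) + (1 - 2 * \<alpha>) * \<phi> 0"
proof -
  define A where "A = (\<lambda>y. {\<omega> \<in> space M. Y z \<omega> = y})"
  have A [measurable]: "A y \<in> sets M" for y unfolding A_def by measurable
  have p: "prob (A 1) = \<alpha>" "prob (A (-1)) = \<alpha>"
    using Y_symmetric[OF z] by (simp_all add: A_def \<alpha>_def)
  have "expectation (\<lambda>\<omega>. \<phi> (Y z \<omega>)) =
    expectation (\<lambda>\<omega>. \<phi> 0 + (\<phi> 1 - \<phi> 0) * indicat_real (A 1) \<omega> + (\<phi> (-1) - \<phi> 0) * indicat_real (A (-1)) \<omega>)"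
  proof (rule Bochner_Integration.integral_cong)
    fix \<omega> assume "\<omega> \<in> space M"
    thus "\<phi> (Y z \<omega>) = \<phi> 0 + (\<phi> 1 - \<phi> 0) * indicat_real (A 1) \<omega> + (\<phi> (-1) - \<phi> 0) * indicat_real (A (-1)) \<omega>"
      using Y_values[of z \<omega>] by (auto simp: A_def indicator_def)
  qed simp
  also have "\<dots> = \<phi> 0 + (\<phi> 1 - \<phi> 0) * prob (A 1) + (\<phi> (-1) - \<phi> 0) * prob (A (-1))"
    by (simp add: prob_space emeasure_eq_measure)
  finally show ?thesis unfolding p by (simp add: algebra_simps)
qed

lemma expectation_disjoint_sites:
  fixes \<phi> \<psi> :: "(int \<times> int \<Rightarrow> int) \<Rightarrow> real"
  assumes AB: "A \<subseteq> even_lattice" "B \<subseteq> even_lattice" "A \<inter> B = {}"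
    and \<phi>: "\<phi> \<in> borel_measurable (PiM A (\<lambda>_. count_space UNIV))"
    and \<psi>: "\<psi> \<in> borel_measurable (PiM B (\<lambda>_. count_space UNIV))"
    and fin: "finite ((\<lambda>\<omega>. \<phi> (restrict (\<lambda>z. Y z \<omega>) A)) ` space M)" "finite ((\<lambda>\<omega>. \<psi> (restrict (\<lambda>z. Y z \<omega>) B)) ` space M)"
  shows "expectation (\<lambda>\<omega>. \<phi> (restrict (\<lambda>z. Y z \<omega>) A) * \<psi> (restrict (\<lambda>z. Y z \<omega>) B)) =
    expectation (\<lambda>\<omega>. \<phi> (restrict (\<lambda>z. Y z \<omega>) A)) * expectation (\<lambda>\<omega>. \<psi> (restrict (\<lambda>z. Y z \<omega>) B))"
proof -
  have R: "(\<lambda>\<omega>. restrict (\<lambda>z. Y z \<omega>) C) \<in> measurable M (PiM C (\<lambda>_. count_space UNIV))" for C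
    by (intro measurable_restrict) simp
  have "indep_var (PiM A (\<lambda>_. count_space UNIV)) (\<lambda>\<omega>. restrict (\<lambda>z. Y z \<omega>) A)
                  (PiM B (\<lambda>_. count_space UNIV)) (\<lambda>\<omega>. restrict (\<lambda>z. Y z \<omega>) B)"
    by (rule indep_var_restrict[OF Y_indep]) (use AB in auto)
  from indep_var_compose[OF this \<phi> \<psi>]
  have "indep_var borel (\<lambda>\<omega>. \<phi> (restrict (\<lambda>z. Y z \<omega>) A)) borel (\<lambda>\<omega>. \<psi> (restrict (\<lambda>z. Y z \<omega>) B))"
    by (simp add: comp_def)
  thus ?thesis
    by (rule indep_var_lebesgue_integral)
       (intro integrable_finite_range fin measurable_compose[OF R \<phi>] measurable_compose[OF R \<psi>])+
qed

text \<open>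
  One step of both walks from \<open>a\<close> and \<open>b\<close> at time \<open>t\<close>. For \<open>a \<noteq> b\<close> the two arrows are independent
  and the expectation factorises. For \<open>a = b\<close> it is smaller than the product of expectations, by
  \<open>\<alpha>\<^sup>2 * (f' (a + 1) - f' (a - 1)) * (g' (a - 1) - g' (a + 1))\<close>, a case of Chebyshev's inequality:
  \<open>upper_arrow\<close> and \<open>lower_arrow\<close> are both nondecreasing in the state, while \<open>f'\<close> and \<open>g'\<close> are monotone in
  opposite directions.
\<close>
lemma expectation_one_step:
  fixes f f' g g' :: "int \<Rightarrow> real"
  assumes lat: "(a, t) \<in> even_lattice" "(b, t) \<in> even_lattice"
    and mono: "f' (a - 1) \<le> f' (a + 1)" "g' (b + 1) \<le> g' (b - 1)"
    and nonneg: "0 \<le> f a" "0 \<le> g' (b - 1)" "0 \<le> g' (b + 1)"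
    and f: "\<And>\<alpha>. (1 - \<delta>) / 2 \<le> \<alpha> \<Longrightarrow> \<alpha> * f' (a - 1) + (1 - \<alpha>) * f' (a + 1) \<le> f a"
    and g: "\<And>\<alpha>. (1 - \<delta>) / 2 \<le> \<alpha> \<Longrightarrow> \<alpha> * g' (b + 1) + (1 - \<alpha>) * g' (b - 1) \<le> g b"
  shows "expectation (\<lambda>\<omega>. f' (a + upper_arrow (Y (a, t) \<omega>)) * g' (b + lower_arrow (Y (b, t) \<omega>))) \<le> f a * g b"
proof -
  define \<alpha> where "\<alpha> x = prob {\<omega> \<in> space M. Y (x, t) \<omega> = 1}" for x
  have \<alpha>: "(1 - \<delta>) / 2 \<le> \<alpha> x" "0 \<le> \<alpha> x" "\<alpha> x \<le> 1" if "(x, t) \<in> even_lattice" for x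
    using Y_weight[OF that] by (simp_all add: \<alpha>_def)
  let ?Ef = "\<alpha> a * f' (a - 1) + (1 - \<alpha> a) * f' (a + 1)"
  let ?Eg = "\<alpha> b * g' (b + 1) + (1 - \<alpha> b) * g' (b - 1)"
  have Ef: "?Ef \<le> f a" and Eg: "?Eg \<le> g b" using f g \<alpha> lat by auto
  have "?Eg \<ge> 0" using \<alpha> lat nonneg by (intro add_nonneg_nonneg mult_nonneg_nonneg) auto
  hence prod: "?Ef * ?Eg \<le> f a * g b" using Ef Eg nonneg by (intro mult_mono) auto
  show ?thesis
  proof (cases "a = b")
    case True
    have "0 \<le> (\<alpha> a)\<^sup>2 * ((f' (a + 1) - f' (a - 1)) * (g' (a - 1) - g' (a + 1)))"
      using mono True by (intro mult_nonneg_nonneg) auto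
    hence "\<alpha> a * (f' (a + 1) * g' (a + 1)) + \<alpha> a * (f' (a - 1) * g' (a - 1)) + (1 - 2 * \<alpha> a) * (f' (a + 1) * g' (a - 1)) \<le> ?Ef * ?Eg"
      using True by (simp add: algebra_simps power2_eq_square)
    moreover have "expectation (\<lambda>\<omega>. f' (a + upper_arrow (Y (a, t) \<omega>)) * g' (b + lower_arrow (Y (b, t) \<omega>)))
       = \<alpha> a * (f' (a + 1) * g' (a + 1)) + \<alpha> a * (f' (a - 1) * g' (a - 1)) + (1 - 2 * \<alpha> a) * (f' (a + 1) * g' (a - 1))"
      unfolding True[symmetric]
      using expectation_Y[OF lat(1), of "\<lambda>y. f' (a + upper_arrow y) * g' (a + lower_arrow y)", folded \<alpha>_def]
      by (simp add: upper_arrow_def lower_arrow_def)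
    ultimately show ?thesis using prod by linarith
  next
    case False
    have Ef_eq: "expectation (\<lambda>\<omega>. f' (a + upper_arrow (Y (a, t) \<omega>))) = ?Ef"
      unfolding expectation_Y[OF lat(1), of "\<lambda>y. f' (a + upper_arrow y)", folded \<alpha>_def]
      by (simp add: upper_arrow_def algebra_simps)
    have Eg_eq: "expectation (\<lambda>\<omega>. g' (b + lower_arrow (Y (b, t) \<omega>))) = ?Eg"
      unfolding expectation_Y[OF lat(2), of "\<lambda>y. g' (b + lower_arrow y)", folded \<alpha>_def]
      by (simp add: lower_arrow_def algebra_simps)
    have "expectation (\<lambda>\<omega>. f' (a + upper_arrow (restrict (\<lambda>z. Y z \<omega>) {(a, t)} (a, t))) * g' (b + lower_arrow (restrict (\<lambda>z. Y z \<omega>) {(b, t)} (b, t))))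
       = expectation (\<lambda>\<omega>. f' (a + upper_arrow (restrict (\<lambda>z. Y z \<omega>) {(a, t)} (a, t))))
       * expectation (\<lambda>\<omega>. g' (b + lower_arrow (restrict (\<lambda>z. Y z \<omega>) {(b, t)} (b, t))))"
    proof (rule expectation_disjoint_sites[of "{(a, t)}" "{(b, t)}" "\<lambda>x. f' (a + upper_arrow (x (a, t)))" "\<lambda>x. g' (b + lower_arrow (x (b, t)))"])
      show "(\<lambda>x. f' (a + upper_arrow (x (a, t)))) \<in> borel_measurable (PiM {(a, t)} (\<lambda>_. count_space UNIV))"
        by (rule measurable_compose[OF measurable_component_singleton[of "(a, t)"]]) auto
      show "(\<lambda>x. g' (b + lower_arrow (x (b, t)))) \<in> borel_measurable (PiM {(b, t)} (\<lambda>_. count_space UNIV))"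
        by (rule measurable_compose[OF measurable_component_singleton[of "(b, t)"]]) auto
      show "finite ((\<lambda>\<omega>. f' (a + upper_arrow (restrict (\<lambda>z. Y z \<omega>) {(a, t)} (a, t)))) ` space M)"
        using finite_range_Y[of "\<lambda>y _. f' (a + upper_arrow y)" "(a, t)"] by simp
      show "finite ((\<lambda>\<omega>. g' (b + lower_arrow (restrict (\<lambda>z. Y z \<omega>) {(b, t)} (b, t)))) ` space M)"
        using finite_range_Y[of "\<lambda>y _. g' (b + lower_arrow y)" "(b, t)"] by simp
    qed (use lat False in auto)
    hence "expectation (\<lambda>\<omega>. f' (a + upper_arrow (Y (a, t) \<omega>)) * g' (b + lower_arrow (Y (b, t) \<omega>))) = ?Ef * ?Eg"
      unfolding Ef_eq[symmetric] Eg_eq[symmetric] by (simp only: restrict_apply insert_iff if_True simp_thms)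
    thus ?thesis using prod by simp
  qed
qed

definition upper_walk :: "nat \<Rightarrow> 'w \<Rightarrow> int" where
  "upper_walk t \<omega> = walk (\<lambda>z. upper_arrow (Y z \<omega>)) t"

definition lower_walk :: "nat \<Rightarrow> 'w \<Rightarrow> int" where
  "lower_walk t \<omega> = walk (\<lambda>z. lower_arrow (Y z \<omega>)) t"

lemma upper_walk_measurable [measurable]: "upper_walk t \<in> measurable M (count_space UNIV)"
  unfolding upper_walk_def by (intro walk_measurable measurable_compose[OF Y_measurable]) simp

lemma lower_walk_measurable [measurable]: "lower_walk t \<in> measurable M (count_space UNIV)"
  unfolding lower_walk_def by (intro walk_measurable measurable_compose[OF Y_measurable]) simp

lemma walks_range:
  "(upper_walk t \<omega>, int t) \<in> even_lattice" "(lower_walk t \<omega>, int t) \<in> even_lattice"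
  "\<bar>upper_walk t \<omega>\<bar> \<le> int t" "\<bar>lower_walk t \<omega>\<bar> \<le> int t"
  unfolding upper_walk_def lower_walk_def
  using walk_range[of "\<lambda>z. upper_arrow (Y z \<omega>)" t] walk_range[of "\<lambda>z. lower_arrow (Y z \<omega>)" t]
  by (auto simp: upper_arrow_def lower_arrow_def)

definition alive :: "(nat \<Rightarrow> int \<Rightarrow> int \<Rightarrow> bool) \<Rightarrow> nat \<Rightarrow> nat \<Rightarrow> 'w set" where
  "alive R t0 t = {\<omega> \<in> space M. \<forall>s\<in>{t0..t}. R s (upper_walk s \<omega>) (lower_walk s \<omega>)}"

lemma alive_measurable [measurable]: "alive R t0 t \<in> sets M"
proof -
  have "Measurable.pred M (\<lambda>\<omega>. R s (upper_walk s \<omega>) (lower_walk s \<omega>))" for s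
    by (rule measurable_countable_binary[OF upper_walk_measurable lower_walk_measurable]) simp
  hence "Measurable.pred M (\<lambda>\<omega>. \<forall>s\<in>{t0..t}. R s (upper_walk s \<omega>) (lower_walk s \<omega>))"
    by (intro pred_intros_finite) auto
  thus ?thesis unfolding alive_def by simp
qed

lemma walks_past:
  fixes x :: "int \<times> int \<Rightarrow> int"
  assumes "\<And>z. z \<in> even_lattice \<Longrightarrow> snd z < int t \<Longrightarrow> x z = Y z \<omega>" and "s \<le> t"
  shows "upper_walk s \<omega> = walk (\<lambda>z. upper_arrow (x z)) s" "lower_walk s \<omega> = walk (\<lambda>z. lower_arrow (x z)) s"
proof -
  have eq: "Y z \<omega> = x z" if "z \<in> even_lattice" "snd z < int s" for z
    using that assms(1)[of z] assms(2) by simp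
  show "upper_walk s \<omega> = walk (\<lambda>z. upper_arrow (x z)) s" unfolding upper_walk_def
    by (rule walk_cong) (simp_all add: eq upper_arrow_def)
  show "lower_walk s \<omega> = walk (\<lambda>z. lower_arrow (x z)) s" unfolding lower_walk_def
    by (rule walk_cong) (simp_all add: eq lower_arrow_def)
qed

text \<open>
  The Markov property in the form needed here: the past up to time \<open>t\<close> is a function of the states
  at levels below \<open>t\<close>. The past is totalised by \<open>0\<close> outside these levels, where the product space has no
  information.
\<close>
lemma expectation_past_present:
  fixes R :: "nat \<Rightarrow> int \<Rightarrow> int \<Rightarrow> bool" and t0 :: nat and \<phi> :: "int \<Rightarrow> int \<Rightarrow> real"
  assumes lat: "(a, int t) \<in> even_lattice" "(b, int t) \<in> even_lattice"
  defines "P \<equiv> {\<omega> \<in> alive R t0 t. upper_walk t \<omega> = a \<and> lower_walk t \<omega> = b}"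
  shows "expectation (\<lambda>\<omega>. indicator P \<omega> * \<phi> (Y (a, int t) \<omega>) (Y (b, int t) \<omega>))
           = prob P * expectation (\<lambda>\<omega>. \<phi> (Y (a, int t) \<omega>) (Y (b, int t) \<omega>))"
proof -
  define A where "A = {z \<in> even_lattice. snd z < int t}"
  define B where "B = {z \<in> even_lattice. snd z = int t}"
  define ext where "ext = (\<lambda>(x :: int \<times> int \<Rightarrow> int) z. if z \<in> A then x z else 0)"
  define past where "past = (\<lambda>x. (\<forall>s\<in>{t0..t}. R s (walk (\<lambda>z. upper_arrow (ext x z)) s) (walk (\<lambda>z. lower_arrow (ext x z)) s))
      \<and> walk (\<lambda>z. upper_arrow (ext x z)) t = a \<and> walk (\<lambda>z. lower_arrow (ext x z)) t = b)"
  let ?N = "PiM A (\<lambda>_. count_space UNIV) :: (int \<times> int \<Rightarrow> int) measure"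
  have "(\<lambda>x. ext x z) \<in> measurable ?N (count_space UNIV)" for z
    unfolding ext_def by (cases "z \<in> A") auto
  hence ext_meas: "(\<lambda>x. h (ext x z)) \<in> measurable ?N (count_space UNIV)" for h :: "int \<Rightarrow> int" and z
    by (rule measurable_compose) simp
  have w: "(\<lambda>x. walk (\<lambda>z. upper_arrow (ext x z)) s) \<in> measurable ?N (count_space UNIV)"
          "(\<lambda>x. walk (\<lambda>z. lower_arrow (ext x z)) s) \<in> measurable ?N (count_space UNIV)" for s
    by (intro walk_measurable ext_meas)+
  have past1: "Measurable.pred ?N (\<lambda>x. R s (walk (\<lambda>z. upper_arrow (ext x z)) s) (walk (\<lambda>z. lower_arrow (ext x z)) s))" for s
    by (rule measurable_countable_binary[OF w]) simp
  have past2: "Measurable.pred ?N (\<lambda>x. walk (\<lambda>z. upper_arrow (ext x z)) t = a \<and> walk (\<lambda>z. lower_arrow (ext x z)) t = b)"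
    by (rule measurable_countable_binary[OF w]) simp
  have past: "Measurable.pred ?N past"
    unfolding past_def by (intro pred_intros_logic pred_intros_finite past1 past2) auto
  have past_eq: "past (restrict (\<lambda>z. Y z \<omega>) A) \<longleftrightarrow> \<omega> \<in> P" if "\<omega> \<in> space M" for \<omega>
  proof -
    have "upper_walk s \<omega> = walk (\<lambda>z. upper_arrow (ext (restrict (\<lambda>z. Y z \<omega>) A) z)) s"
      "lower_walk s \<omega> = walk (\<lambda>z. lower_arrow (ext (restrict (\<lambda>z. Y z \<omega>) A) z)) s" if "s \<le> t" for s
      by (rule walks_past[OF _ that]; simp add: ext_def A_def)+
    thus ?thesis using that unfolding past_def P_def alive_def by auto
  qed
  let ?\<phi> = "\<lambda>x. indicat_real {x. past x} x" and ?\<psi> = "\<lambda>x. \<phi> (x (a, int t)) (x (b, int t))"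
  have AB: "(a, int t) \<in> B" "(b, int t) \<in> B" using lat by (auto simp: B_def)
  have "expectation (\<lambda>\<omega>. ?\<phi> (restrict (\<lambda>z. Y z \<omega>) A) * ?\<psi> (restrict (\<lambda>z. Y z \<omega>) B)) =
    expectation (\<lambda>\<omega>. ?\<phi> (restrict (\<lambda>z. Y z \<omega>) A)) * expectation (\<lambda>\<omega>. ?\<psi> (restrict (\<lambda>z. Y z \<omega>) B))"
  proof (rule expectation_disjoint_sites)
    show "?\<phi> \<in> borel_measurable ?N"
    proof -
      have "(\<lambda>x. if past x then 1 else 0 :: real) \<in> borel_measurable ?N" using past by measurable
      also have "(\<lambda>x. if past x then 1 else 0 :: real) = ?\<phi>" by (auto simp: indicator_def fun_eq_iff)
      finally show ?thesis .
    qed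
    show "?\<psi> \<in> borel_measurable (PiM B (\<lambda>_. count_space UNIV))"
      by (rule measurable_countable_binary) (use AB in \<open>auto intro: measurable_component_singleton\<close>)
    show "finite ((\<lambda>\<omega>. ?\<phi> (restrict (\<lambda>z. Y z \<omega>) A)) ` space M)"
      by (rule finite_subset[of _ "{0, 1}"]) (auto simp: indicator_def)
    show "finite ((\<lambda>\<omega>. ?\<psi> (restrict (\<lambda>z. Y z \<omega>) B)) ` space M)"
      using finite_range_Y[of \<phi> "(a, int t)" "(b, int t)"] AB by simp
  qed (auto simp: A_def B_def)
  also have "expectation (\<lambda>\<omega>. ?\<phi> (restrict (\<lambda>z. Y z \<omega>) A)) = expectation (indicator P)"
    by (rule Bochner_Integration.integral_cong) (auto simp: indicator_def past_eq)
  also have "\<dots> = prob P"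
    by (simp add: P_def alive_def)
  also have "expectation (\<lambda>\<omega>. ?\<phi> (restrict (\<lambda>z. Y z \<omega>) A) * ?\<psi> (restrict (\<lambda>z. Y z \<omega>) B))
     = expectation (\<lambda>\<omega>. indicator P \<omega> * \<phi> (Y (a, int t) \<omega>) (Y (b, int t) \<omega>))"
    by (rule Bochner_Integration.integral_cong) (use AB in \<open>auto simp: indicator_def past_eq\<close>)
  also have "expectation (\<lambda>\<omega>. ?\<psi> (restrict (\<lambda>z. Y z \<omega>) B)) = expectation (\<lambda>\<omega>. \<phi> (Y (a, int t) \<omega>) (Y (b, int t) \<omega>))"
    using AB by simp
  finally show ?thesis .
qed

lemma integrable_walk_functional:
  fixes h :: "int \<Rightarrow> int \<Rightarrow> real"
  assumes "A \<in> sets M"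
  shows "integrable M (\<lambda>\<omega>. indicator A \<omega> * h (upper_walk t \<omega>) (lower_walk t \<omega>))"
proof -
  have "integrable M (\<lambda>\<omega>. h (upper_walk t \<omega>) (lower_walk t \<omega>))"
  proof (rule integrable_finite_range)
    show "(\<lambda>\<omega>. h (upper_walk t \<omega>) (lower_walk t \<omega>)) \<in> borel_measurable M"
      by (rule measurable_countable_binary[OF upper_walk_measurable lower_walk_measurable]) simp
    show "finite ((\<lambda>\<omega>. h (upper_walk t \<omega>) (lower_walk t \<omega>)) ` space M)"
    proof (rule finite_subset)
      show "(\<lambda>\<omega>. h (upper_walk t \<omega>) (lower_walk t \<omega>)) ` space M \<subseteq> case_prod h ` ({-int t..int t} \<times> {-int t..int t})"
      proof
        fix r assume "r \<in> (\<lambda>\<omega>. h (upper_walk t \<omega>) (lower_walk t \<omega>)) ` space M"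
        then obtain \<omega> where "r = h (upper_walk t \<omega>) (lower_walk t \<omega>)" by blast
        moreover have "upper_walk t \<omega> \<in> {-int t..int t}" "lower_walk t \<omega> \<in> {-int t..int t}"
          using walks_range(3,4)[of t \<omega>] by auto
        ultimately show "r \<in> case_prod h ` ({-int t..int t} \<times> {-int t..int t})"
          by (intro image_eqI[of _ _ "(upper_walk t \<omega>, lower_walk t \<omega>)"]) auto
      qed
    qed auto
  qed
  from integrable_real_mult_indicator[OF assms this] show ?thesis by (simp add: mult.commute)
qed

text \<open>
  Split according to the positions at time \<open>t\<close>; on each piece \<open>expectation_past_present\<close> separates the
  past from the next arrows and \<open>expectation_one_step\<close> bounds the contribution of the latter.
  Killing the walks that violate \<open>R\<close> at time \<open>t + 1\<close> only decreases the expectation, because one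
  step after a time with \<open>R\<close> both factors are still nonnegative.
\<close>
lemma product_supermartingale:
  fixes f g :: "nat \<Rightarrow> int \<Rightarrow> real" and R :: "nat \<Rightarrow> int \<Rightarrow> int \<Rightarrow> bool"
  assumes "t0 \<le> t"
    and mono: "mono (f (Suc t))" "antimono (g (Suc t))"
    and nonneg: "\<And>a b. R t a b \<Longrightarrow> 0 \<le> f t a \<and> 0 \<le> f (Suc t) (a - 1) \<and> 0 \<le> f (Suc t) (a + 1)
                   \<and> 0 \<le> g (Suc t) (b - 1) \<and> 0 \<le> g (Suc t) (b + 1)"
    and f: "\<And>\<alpha> a. (1 - \<delta>) / 2 \<le> \<alpha> \<Longrightarrow> \<alpha> * f (Suc t) (a - 1) + (1 - \<alpha>) * f (Suc t) (a + 1) \<le> f t a"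
    and g: "\<And>\<alpha> b. (1 - \<delta>) / 2 \<le> \<alpha> \<Longrightarrow> \<alpha> * g (Suc t) (b + 1) + (1 - \<alpha>) * g (Suc t) (b - 1) \<le> g t b"
  shows "expectation (\<lambda>\<omega>. indicator (alive R t0 (Suc t)) \<omega> * (f (Suc t) (upper_walk (Suc t) \<omega>) * g (Suc t) (lower_walk (Suc t) \<omega>)))
       \<le> expectation (\<lambda>\<omega>. indicator (alive R t0 t) \<omega> * (f t (upper_walk t \<omega>) * g t (lower_walk t \<omega>)))"
proof -
  define Q where "Q = {(a, b). (a, int t) \<in> even_lattice \<and> (b, int t) \<in> even_lattice \<and> \<bar>a\<bar> \<le> int t \<and> \<bar>b\<bar> \<le> int t}"
  define P where "P = (\<lambda>(a, b). {\<omega> \<in> alive R t0 t. upper_walk t \<omega> = a \<and> lower_walk t \<omega> = b})"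
  define next_value where "next_value = (\<lambda>(a, b) \<omega>. f (Suc t) (a + upper_arrow (Y (a, int t) \<omega>)) * g (Suc t) (b + lower_arrow (Y (b, int t) \<omega>)))"
  have "Q \<subseteq> {-int t..int t} \<times> {-int t..int t}" by (auto simp: Q_def)
  hence finQ: "finite Q" by (rule finite_subset) auto
  have P_meas: "P ab \<in> sets M" for ab
  proof -
    obtain a b where ab: "ab = (a, b)" by (cases ab)
    have "P ab = alive R t0 t \<inter> {\<omega> \<in> space M. upper_walk t \<omega> = a \<and> lower_walk t \<omega> = b}"
      by (auto simp: P_def ab alive_def)
    also have "\<dots> \<in> sets M" by measurable
    finally show ?thesis .
  qed
  have decomp: "(\<Sum>ab\<in>Q. indicator (P ab) \<omega> * h ab) = indicator (alive R t0 t) \<omega> * h (upper_walk t \<omega>, lower_walk t \<omega>)"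
    for h :: "int \<times> int \<Rightarrow> real" and \<omega>
  proof -
    have "(\<Sum>ab\<in>Q. indicator (P ab) \<omega> * h ab) =
        (\<Sum>ab\<in>Q. if ab = (upper_walk t \<omega>, lower_walk t \<omega>) then indicator (alive R t0 t) \<omega> * h ab else 0)"
      by (intro sum.cong refl) (auto simp: P_def indicator_def split: prod.splits)
    also have "(upper_walk t \<omega>, lower_walk t \<omega>) \<in> Q" unfolding Q_def using walks_range[of t \<omega>] by auto
    hence "(\<Sum>ab\<in>Q. if ab = (upper_walk t \<omega>, lower_walk t \<omega>) then indicator (alive R t0 t) \<omega> * h ab else 0)
        = indicator (alive R t0 t) \<omega> * h (upper_walk t \<omega>, lower_walk t \<omega>)"
      using finQ by (simp add: sum.delta)
    finally show ?thesis .
  qed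
  have next_eq: "next_value (upper_walk t \<omega>, lower_walk t \<omega>) \<omega> = f (Suc t) (upper_walk (Suc t) \<omega>) * g (Suc t) (lower_walk (Suc t) \<omega>)" for \<omega>
    by (simp add: next_value_def upper_walk_def lower_walk_def)
  have int_next: "integrable M (\<lambda>\<omega>. indicator (P ab) \<omega> * next_value ab \<omega>)" for ab
  proof -
    obtain a b where ab: "ab = (a, b)" by (cases ab)
    have "integrable M (\<lambda>\<omega>. (\<lambda>y y'. f (Suc t) (a + upper_arrow y) * g (Suc t) (b + lower_arrow y')) (Y (a, int t) \<omega>) (Y (b, int t) \<omega>))"
      by (intro integrable_finite_range finite_range_Y measurable_countable_binary[OF Y_measurable Y_measurable]) auto
    hence "integrable M (next_value ab)" by (simp add: ab next_value_def)
    from integrable_real_mult_indicator[OF P_meas this] show ?thesis by (simp add: mult.commute)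
  qed
  have "expectation (\<lambda>\<omega>. indicator (alive R t0 (Suc t)) \<omega> * (f (Suc t) (upper_walk (Suc t) \<omega>) * g (Suc t) (lower_walk (Suc t) \<omega>)))
      \<le> expectation (\<lambda>\<omega>. \<Sum>ab\<in>Q. indicator (P ab) \<omega> * next_value ab \<omega>)"
  proof (rule integral_mono)
    fix \<omega> assume \<omega>: "\<omega> \<in> space M"
    show "indicator (alive R t0 (Suc t)) \<omega> * (f (Suc t) (upper_walk (Suc t) \<omega>) * g (Suc t) (lower_walk (Suc t) \<omega>))
      \<le> (\<Sum>ab\<in>Q. indicator (P ab) \<omega> * next_value ab \<omega>)"
      unfolding decomp[of \<omega> "\<lambda>ab. next_value ab \<omega>"] next_eq
    proof (cases "\<omega> \<in> alive R t0 t")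
      case True
      hence "R t (upper_walk t \<omega>) (lower_walk t \<omega>)" using \<open>t0 \<le> t\<close> by (auto simp: alive_def)
      note n = nonneg[OF this]
      have "f (Suc t) (upper_walk (Suc t) \<omega>) \<ge> 0" "g (Suc t) (lower_walk (Suc t) \<omega>) \<ge> 0"
        using n by (auto simp: upper_walk_def lower_walk_def upper_arrow_def lower_arrow_def)
      thus "indicator (alive R t0 (Suc t)) \<omega> * (f (Suc t) (upper_walk (Suc t) \<omega>) * g (Suc t) (lower_walk (Suc t) \<omega>))
        \<le> indicator (alive R t0 t) \<omega> * (f (Suc t) (upper_walk (Suc t) \<omega>) * g (Suc t) (lower_walk (Suc t) \<omega>))"
        using True by (auto simp: indicator_def)
    next
      case False
      hence "\<omega> \<notin> alive R t0 (Suc t)" by (auto simp: alive_def)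
      with False show "indicator (alive R t0 (Suc t)) \<omega> * (f (Suc t) (upper_walk (Suc t) \<omega>) * g (Suc t) (lower_walk (Suc t) \<omega>))
        \<le> indicator (alive R t0 t) \<omega> * (f (Suc t) (upper_walk (Suc t) \<omega>) * g (Suc t) (lower_walk (Suc t) \<omega>))"
        by simp
    qed
  qed (intro integrable_walk_functional[of _ "\<lambda>x y. f (Suc t) x * g (Suc t) y"] alive_measurable Bochner_Integration.integrable_sum int_next)+
  also have "\<dots> = (\<Sum>ab\<in>Q. expectation (\<lambda>\<omega>. indicator (P ab) \<omega> * next_value ab \<omega>))"
    by (rule Bochner_Integration.integral_sum) (rule int_next)
  also have "\<dots> \<le> (\<Sum>ab\<in>Q. prob (P ab) * (f t (fst ab) * g t (snd ab)))"
  proof (rule sum_mono)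
    fix ab assume "ab \<in> Q"
    then obtain a b where ab: "ab = (a, b)" and lat: "(a, int t) \<in> even_lattice" "(b, int t) \<in> even_lattice"
      by (auto simp: Q_def)
    have eq: "expectation (\<lambda>\<omega>. indicator (P ab) \<omega> * next_value ab \<omega>) = prob (P ab) * expectation (next_value ab)"
      using expectation_past_present[OF lat, of R t0 "\<lambda>y y'. f (Suc t) (a + upper_arrow y) * g (Suc t) (b + lower_arrow y')"]
      by (simp add: P_def next_value_def ab)
    show "expectation (\<lambda>\<omega>. indicator (P ab) \<omega> * next_value ab \<omega>) \<le> prob (P ab) * (f t (fst ab) * g t (snd ab))"
    proof (cases "R t a b")
      case True
      note n = nonneg[OF True]
      have "expectation (next_value ab) \<le> f t a * g t b"
        unfolding ab next_value_def prod.case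
      proof (rule expectation_one_step[OF lat])
        show "f (Suc t) (a - 1) \<le> f (Suc t) (a + 1)" by (rule monoD[OF mono(1)]) simp
        show "g (Suc t) (b + 1) \<le> g (Suc t) (b - 1)" by (rule antimonoD[OF mono(2)]) simp
      qed (use n f g in auto)
      thus ?thesis unfolding eq by (intro mult_left_mono) (auto simp: ab)
    next
      case False
      hence "P ab = {}" using \<open>t0 \<le> t\<close> by (auto simp: P_def ab alive_def)
      thus ?thesis by simp
    qed
  qed
  also have "\<dots> = (\<Sum>ab\<in>Q. expectation (\<lambda>\<omega>. indicator (P ab) \<omega> * (f t (fst ab) * g t (snd ab))))"
    using P_meas by (intro sum.cong refl) (simp add: sets.Int_space_eq2)
  also have "\<dots> = expectation (\<lambda>\<omega>. \<Sum>ab\<in>Q. indicator (P ab) \<omega> * (f t (fst ab) * g t (snd ab)))"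
    by (rule Bochner_Integration.integral_sum[symmetric])
       (use P_meas in \<open>auto intro!: integrable_real_indicator simp: emeasure_eq_measure\<close>)
  also have "\<dots> = expectation (\<lambda>\<omega>. indicator (alive R t0 t) \<omega> * (f t (upper_walk t \<omega>) * g t (lower_walk t \<omega>)))"
    unfolding decomp by simp
  finally show ?thesis .
qed

lemma prob_alive_bound:
  fixes f g :: "nat \<Rightarrow> int \<Rightarrow> real" and R :: "nat \<Rightarrow> int \<Rightarrow> int \<Rightarrow> bool"
  assumes "t0 \<le> n"
    and mono: "\<And>t. mono (f t)" "\<And>t. antimono (g t)"
    and nonneg: "\<And>t a b. t0 \<le> t \<Longrightarrow> t < n \<Longrightarrow> R t a b \<Longrightarrow> 0 \<le> f t a \<and> 0 \<le> f (Suc t) (a - 1) \<and> 0 \<le> f (Suc t) (a + 1)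
                   \<and> 0 \<le> g (Suc t) (b - 1) \<and> 0 \<le> g (Suc t) (b + 1)"
    and f: "\<And>t \<alpha> a. (1 - \<delta>) / 2 \<le> \<alpha> \<Longrightarrow> \<alpha> * f (Suc t) (a - 1) + (1 - \<alpha>) * f (Suc t) (a + 1) \<le> f t a"
    and g: "\<And>t \<alpha> b. (1 - \<delta>) / 2 \<le> \<alpha> \<Longrightarrow> \<alpha> * g (Suc t) (b + 1) + (1 - \<alpha>) * g (Suc t) (b - 1) \<le> g t b"
    and start: "\<And>a b. R t0 a b \<Longrightarrow> \<bar>a\<bar> \<le> int t0 \<Longrightarrow> \<bar>b\<bar> \<le> int t0 \<Longrightarrow> f t0 a * g t0 b \<le> C" and C: "0 \<le> C"
    and final: "\<And>a b. R n a b \<Longrightarrow> c \<le> f n a * g n b"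
  shows "c * prob (alive R t0 n) \<le> C"
proof -
  define V where "V = (\<lambda>t. expectation (\<lambda>\<omega>. indicator (alive R t0 t) \<omega> * (f t (upper_walk t \<omega>) * g t (lower_walk t \<omega>))))"
  have int: "integrable M (\<lambda>\<omega>. indicator (alive R t0 t) \<omega> * (f t (upper_walk t \<omega>) * g t (lower_walk t \<omega>)))" for t
    by (rule integrable_walk_functional[of _ "\<lambda>x y. f t x * g t y"]) simp
  have int_c: "integrable M (\<lambda>\<omega>. indicator (alive R t0 t) \<omega> * (d :: real))" for t d
    by (auto intro!: integrable_real_indicator simp: emeasure_eq_measure)
  have V_le: "V t \<le> V t0" if "t0 \<le> t" "t \<le> n" for t
    using that
  proof (induction rule: dec_induct)
    case (step t)
    have "V (Suc t) \<le> V t" unfolding V_def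
      by (rule product_supermartingale[OF step(1) mono]) (use step nonneg f g in auto)
    with step show ?case by simp
  qed simp
  have "c * prob (alive R t0 n) = expectation (\<lambda>\<omega>. indicator (alive R t0 n) \<omega> * c)"
    by (simp add: sets.Int_space_eq2)
  also have "\<dots> \<le> V n" unfolding V_def
  proof (rule integral_mono[OF int_c int])
    fix \<omega>
    have "R n (upper_walk n \<omega>) (lower_walk n \<omega>)" if "\<omega> \<in> alive R t0 n"
      using that \<open>t0 \<le> n\<close> by (auto simp: alive_def)
    thus "indicator (alive R t0 n) \<omega> * c \<le> indicator (alive R t0 n) \<omega> * (f n (upper_walk n \<omega>) * g n (lower_walk n \<omega>))"
      using final by (auto simp: indicator_def)
  qed
  also have "V n \<le> V t0" using V_le \<open>t0 \<le> n\<close> by simp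
  also have "V t0 \<le> expectation (\<lambda>\<omega>. C)" unfolding V_def
  proof (rule integral_mono[OF int])
    fix \<omega>
    show "indicator (alive R t0 t0) \<omega> * (f t0 (upper_walk t0 \<omega>) * g t0 (lower_walk t0 \<omega>)) \<le> C"
    proof (cases "\<omega> \<in> alive R t0 t0")
      case True
      hence "R t0 (upper_walk t0 \<omega>) (lower_walk t0 \<omega>)" by (auto simp: alive_def)
      thus ?thesis using start walks_range(3,4)[of t0 \<omega>] True by simp
    qed (use C in auto)
  qed simp
  also have "\<dots> = C" by (simp add: prob_space)
  finally show ?thesis .
qed

end

section \<open>The states of the sites during a short dynamical interval\<close>

text \<open>
  The value that carries a quiet index is in force throughout the closed interval from \<open>s\<close> to \<open>s + \<delta>\<close>.
\<close>
definition quiet :: "real \<Rightarrow> real \<Rightarrow> (nat \<Rightarrow> real) \<Rightarrow> nat \<Rightarrow> bool" where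
  "quiet s \<delta> w n \<longleftrightarrow> ring_time w n \<le> s \<and> s + \<delta> < ring_time w (Suc n)"

text \<open>
  For increasing ring times at most one index is quiet. Choosing the least one makes the cases
  disjoint for every sample point and not just almost surely.
\<close>
definition site_state :: "real \<Rightarrow> real \<Rightarrow> (nat \<Rightarrow> real) \<Rightarrow> (nat \<Rightarrow> real) \<Rightarrow> int" where
  "site_state s \<delta> w u =
     (if \<exists>n. quiet s \<delta> w n then (if u (LEAST n. quiet s \<delta> w n) = 1 then 1 else -1) else 0)"

lemma quiet_measurable:
  assumes [measurable]: "\<And>n. (\<lambda>x. w x n) \<in> borel_measurable N"
  shows "Measurable.pred N (\<lambda>x. quiet s \<delta> (w x) n)"
  unfolding quiet_def ring_time_def by measurable

lemma site_state_measurable: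
  assumes w: "\<And>n. (\<lambda>x. w x n) \<in> borel_measurable N" and u: "\<And>n. (\<lambda>x. u x n) \<in> borel_measurable N"
  shows "(\<lambda>x. site_state s \<delta> (w x) (u x)) \<in> measurable N (count_space UNIV)"
proof -
  note q [measurable] = quiet_measurable[OF w]
  have "(\<lambda>x. u x (LEAST n. quiet s \<delta> (w x) n)) \<in> borel_measurable N"
    by (rule measurable_compose_countable[OF u measurable_Least]) (rule q)
  hence [measurable]: "Measurable.pred N (\<lambda>x. u x (LEAST n. quiet s \<delta> (w x) n) = 1)" by measurable
  show ?thesis unfolding site_state_def by measurable
qed

lemma not_quiet_cases:
  assumes "0 \<le> s" and "\<And>n. \<not> quiet s \<delta> w n"
  shows "(\<exists>n. ring_time w (Suc n) \<in> {s<..s + \<delta>}) \<or> (\<forall>n. ring_time w (Suc n) \<le> s)"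
proof (rule disjCI)
  assume "\<not> (\<forall>n. ring_time w (Suc n) \<le> s)"
  then obtain n where n: "ring_time w (Suc n) > s" by (auto simp: not_le)
  define k where "k = (LEAST k. ring_time w k > s)"
  have k: "ring_time w k > s" unfolding k_def by (rule LeastI[of _ "Suc n"]) (rule n)
  have "ring_time w 0 \<le> s" using assms(1) by (simp add: ring_time_def)
  hence "k \<noteq> 0" using k by (metis not_le)
  then obtain i where i: "k = Suc i" by (cases k) auto
  have "\<not> ring_time w i > s" using not_less_Least[of i "\<lambda>k. ring_time w k > s"] i by (auto simp: k_def)
  hence "\<not> s + \<delta> < ring_time w (Suc i)" using assms(2)[of i] by (auto simp: quiet_def)
  thus "\<exists>n. ring_time w (Suc n) \<in> {s<..s + \<delta>}" using k i by auto
qed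

text \<open>
  The renewal density of the Poisson process is constant.
\<close>
lemma erlang_density_sums:
  assumes "x \<ge> 0"
  shows "(\<lambda>n. erlang_density n 1 x) sums 1"
proof -
  have "(\<lambda>n. exp (-x) * (x ^ n /\<^sub>R fact n)) sums (exp (-x) * exp x)"
    by (intro sums_mult exp_converges)
  thus ?thesis using assms by (simp add: erlang_density_def scaleR_conv_of_real divide_inverse mult_ac flip: exp_add)
qed

context dynamical_discrete_web
begin

lemma W_measurable: "z \<in> even_lattice \<Longrightarrow> W z n \<in> borel_measurable M"
  using distributed_measurable[OF waiting_time] by simp

lemma U_measurable: "z \<in> even_lattice \<Longrightarrow> (\<lambda>\<omega>. real_of_int (U z n \<omega>)) \<in> borel_measurable M"
  by (rule measurable_compose[OF value_measurable]) auto

lemma ring_time_distributed: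
  assumes z: "z \<in> even_lattice"
  shows "distributed M lborel (\<lambda>\<omega>. ring_time (\<lambda>i. W z i \<omega>) (Suc n)) (erlang_density n 1)"
proof -
  let ?I = "(even_lattice \<times> UNIV) <+> (even_lattice \<times> UNIV) :: ((int \<times> int) \<times> nat + (int \<times> int) \<times> nat) set"
  have "indep_vars (\<lambda>_. borel) (\<lambda>i. case i of Inl (z, n) \<Rightarrow> W z n | Inr (z, n) \<Rightarrow> (\<lambda>\<omega>. real_of_int (U z n \<omega>)))
     ((\<lambda>k. Inl (z, k)) ` {..n})"
    by (rule indep_vars_subset[OF indep]) (use z in auto)
  hence "distributed M lborel (\<lambda>\<omega>. \<Sum>i\<in>(\<lambda>k. Inl (z, k)) ` {..n}.
      (case i of Inl (z, n) \<Rightarrow> W z n | Inr (z, n) \<Rightarrow> (\<lambda>\<omega>. real_of_int (U z n \<omega>))) \<omega>)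
      (erlang_density (card ((\<lambda>k. Inl (z, k) :: (int \<times> int) \<times> nat + (int \<times> int) \<times> nat) ` {..n}) - 1) 1)"
    by (intro exponential_distributed_sum) (use waiting_time[OF z] in auto)
  moreover have "card ((\<lambda>k. Inl (z, k) :: (int \<times> int) \<times> nat + (int \<times> int) \<times> nat) ` {..n}) = Suc n"
    by (subst card_image) (auto simp: inj_on_def)
  moreover have "(\<Sum>i\<in>(\<lambda>k. Inl (z, k)) ` {..n}.
      (case i of Inl (z, n) \<Rightarrow> W z n | Inr (z, n) \<Rightarrow> (\<lambda>\<omega>. real_of_int (U z n \<omega>))) \<omega>) = ring_time (\<lambda>i. W z i \<omega>) (Suc n)" for \<omega>
    unfolding ring_time_def lessThan_Suc_atMost by (subst sum.reindex) (auto simp: inj_on_def)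
  ultimately show ?thesis by simp
qed

lemma ring_time_measurable: "z \<in> even_lattice \<Longrightarrow> (\<lambda>\<omega>. ring_time (\<lambda>i. W z i \<omega>) n) \<in> borel_measurable M"
  unfolding ring_time_def by (intro borel_measurable_sum W_measurable)

lemma expected_number_of_rings:
  assumes z: "z \<in> even_lattice" and A: "A \<in> sets borel"
  shows "(\<Sum>n. emeasure M {\<omega> \<in> space M. ring_time (\<lambda>i. W z i \<omega>) (Suc n) \<in> A}) = emeasure lborel (A \<inter> {0..})"
proof -
  have "emeasure M {\<omega> \<in> space M. ring_time (\<lambda>i. W z i \<omega>) (Suc n) \<in> A}
      = (\<integral>\<^sup>+x. ennreal (erlang_density n 1 x) * indicator A x \<partial>lborel)" for n
    using distributed_emeasure[OF ring_time_distributed[OF z], of A n] A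
    by (simp add: vimage_def Int_def conj_commute)
  hence "(\<Sum>n. emeasure M {\<omega> \<in> space M. ring_time (\<lambda>i. W z i \<omega>) (Suc n) \<in> A})
      = (\<Sum>n. \<integral>\<^sup>+x. ennreal (erlang_density n 1 x) * indicator A x \<partial>lborel)" by simp
  also have "\<dots> = (\<integral>\<^sup>+x. (\<Sum>n. ennreal (erlang_density n 1 x) * indicator A x) \<partial>lborel)"
    using A by (intro nn_integral_suminf[symmetric]) auto
  also have "\<dots> = (\<integral>\<^sup>+x. indicator (A \<inter> {0..}) x \<partial>lborel)"
  proof (rule nn_integral_cong)
    fix x :: real
    show "(\<Sum>n. ennreal (erlang_density n 1 x) * indicator A x) = indicator (A \<inter> {0..}) x"
    proof (cases "x \<ge> 0")
      case True
      have "(\<Sum>n. ennreal (erlang_density n 1 x)) = ennreal 1"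
        by (rule suminf_ennreal_eq[OF _ erlang_density_sums[OF True]]) simp
      thus ?thesis using True by (auto simp: indicator_def)
    qed (simp add: erlang_density_def)
  qed
  also have "\<dots> = emeasure lborel (A \<inter> {0..})" using A by simp
  finally show ?thesis .
qed

text \<open>
  Otherwise the expected number of rings before \<open>s\<close> would be infinite.
\<close>
lemma ring_times_unbounded:
  assumes z: "z \<in> even_lattice"
  shows "emeasure M {\<omega> \<in> space M. \<forall>n. ring_time (\<lambda>i. W z i \<omega>) (Suc n) \<le> s} = 0"
proof -
  define B where "B = {\<omega> \<in> space M. \<forall>n. ring_time (\<lambda>i. W z i \<omega>) (Suc n) \<le> s}"
  note [measurable] = ring_time_measurable[OF z]
  have le: "of_nat N * emeasure M B \<le> ennreal \<bar>s\<bar>" for N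
  proof -
    have "of_nat N * emeasure M B = (\<Sum>n<N. emeasure M B)" by simp
    also have "\<dots> \<le> (\<Sum>n<N. emeasure M {\<omega> \<in> space M. ring_time (\<lambda>i. W z i \<omega>) (Suc n) \<in> {..s}})"
      by (intro sum_mono emeasure_mono) (auto simp: B_def)
    also have "\<dots> \<le> (\<Sum>n. emeasure M {\<omega> \<in> space M. ring_time (\<lambda>i. W z i \<omega>) (Suc n) \<in> {..s}})"
      by (rule sum_le_suminf) auto
    also have "\<dots> = emeasure lborel ({..s} \<inter> {0..})" by (rule expected_number_of_rings[OF z]) auto
    also have "\<dots> \<le> emeasure lborel {0..\<bar>s\<bar>}" by (rule emeasure_mono) auto
    also have "\<dots> = ennreal \<bar>s\<bar>" by simp
    finally show ?thesis .
  qed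
  have bound: "real N * prob B \<le> \<bar>s\<bar>" for N
    using le[of N] by (simp add: emeasure_eq_measure ennreal_of_nat_eq_real_of_nat flip: ennreal_mult)
  have "prob B = 0"
  proof (rule ccontr)
    assume "prob B \<noteq> 0"
    hence "prob B > 0" by (simp add: zero_less_measure_iff)
    then obtain N :: nat where "real N * prob B > \<bar>s\<bar>" using reals_Archimedean3 by blast
    with bound[of N] show False by simp
  qed
  thus ?thesis by (simp add: B_def emeasure_eq_measure)
qed

text \<open>
  If no index is quiet, then a ring falls into \<open>{s<..s + \<delta>}\<close>, where the expected number of rings is
  \<open>\<delta>\<close>, or all rings come before \<open>s\<close>, which has probability \<open>0\<close>.
\<close>
lemma prob_not_quiet:
  assumes z: "z \<in> even_lattice" and s: "0 \<le> s" "0 \<le> \<delta>"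
  shows "prob {\<omega> \<in> space M. \<forall>n. \<not> quiet s \<delta> (\<lambda>i. W z i \<omega>) n} \<le> \<delta>"
proof -
  note [measurable] = ring_time_measurable[OF z]
  let ?T = "\<lambda>n \<omega>. ring_time (\<lambda>i. W z i \<omega>) (Suc n)"
  have "emeasure M {\<omega> \<in> space M. \<forall>n. \<not> quiet s \<delta> (\<lambda>i. W z i \<omega>) n}
     \<le> emeasure M ((\<Union>n. {\<omega> \<in> space M. ?T n \<omega> \<in> {s<..s+\<delta>}}) \<union> {\<omega> \<in> space M. \<forall>n. ?T n \<omega> \<le> s})"
  proof (rule emeasure_mono)
    show "{\<omega> \<in> space M. \<forall>n. \<not> quiet s \<delta> (\<lambda>i. W z i \<omega>) n} \<subseteq>
        (\<Union>n. {\<omega> \<in> space M. ?T n \<omega> \<in> {s<..s+\<delta>}}) \<union> {\<omega> \<in> space M. \<forall>n. ?T n \<omega> \<le> s}"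
      using not_quiet_cases[OF s(1)] by fastforce
  qed measurable
  also have "\<dots> \<le> emeasure M (\<Union>n. {\<omega> \<in> space M. ?T n \<omega> \<in> {s<..s+\<delta>}}) + emeasure M {\<omega> \<in> space M. \<forall>n. ?T n \<omega> \<le> s}"
    by (rule emeasure_subadditive) measurable
  also have "\<dots> = emeasure M (\<Union>n. {\<omega> \<in> space M. ?T n \<omega> \<in> {s<..s+\<delta>}})"
    by (simp add: ring_times_unbounded[OF z])
  also have "\<dots> \<le> (\<Sum>n. emeasure M {\<omega> \<in> space M. ?T n \<omega> \<in> {s<..s+\<delta>}})"
    by (rule emeasure_subadditive_countably) auto
  also have "\<dots> = emeasure lborel ({s<..s+\<delta>} \<inter> {0..})" by (rule expected_number_of_rings[OF z]) auto
  also have "\<dots> \<le> emeasure lborel {s<..s+\<delta>}" by (rule emeasure_mono) auto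
  also have "\<dots> = ennreal \<delta>" using s by simp
  finally show ?thesis using s by (simp add: emeasure_eq_measure)
qed

lemma prob_value_1: "z \<in> even_lattice \<Longrightarrow> prob {\<omega> \<in> space M. U z n \<omega> = 1} = 1 / 2"
proof -
  assume z: "z \<in> even_lattice"
  have "prob {\<omega> \<in> space M. U z n \<omega> = 1} = measure (distr M (count_space UNIV) (U z n)) {1}"
    using value_measurable[OF z] by (subst measure_distr) (auto simp: vimage_def Int_def conj_commute)
  also have "\<dots> = 1 / 2" unfolding value_uniform[OF z] by (simp add: measure_pmf_single)
  finally show ?thesis .
qed

definition interval_state :: "real \<Rightarrow> real \<Rightarrow> int \<times> int \<Rightarrow> 'w \<Rightarrow> int" where
  "interval_state s \<delta> z \<omega> = (if z \<in> even_lattice then site_state s \<delta> (\<lambda>n. W z n \<omega>) (\<lambda>n. real_of_int (U z n \<omega>)) else 0)"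

lemma interval_state_measurable: "interval_state s \<delta> z \<in> measurable M (count_space UNIV)"
  unfolding interval_state_def
  by (cases "z \<in> even_lattice") (auto intro!: site_state_measurable W_measurable U_measurable)

lemma interval_state_indep: "indep_vars (\<lambda>_. count_space UNIV) (interval_state s \<delta>) even_lattice"
proof -
  define K where "K = (\<lambda>z :: int \<times> int. Inl ` ({z} \<times> UNIV) \<union> Inr ` ({z} \<times> UNIV) :: ((int \<times> int) \<times> nat + (int \<times> int) \<times> nat) set)"
  let ?X = "\<lambda>i. case i of Inl (z, n) \<Rightarrow> W z n | Inr (z, n) \<Rightarrow> (\<lambda>\<omega>. real_of_int (U z n \<omega>))"
  define Y where "Y = (\<lambda>(z :: int \<times> int) x. site_state s \<delta> (\<lambda>n. x (Inl (z, n))) (\<lambda>n. x (Inr (z, n))))"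
  have "indep_vars (\<lambda>z. PiM (K z) (\<lambda>_. borel)) (\<lambda>z \<omega>. restrict (\<lambda>i. ?X i \<omega>) (K z)) even_lattice"
    by (rule indep_vars_restrict[OF indep]) (auto simp: K_def disjoint_family_on_def)
  hence "indep_vars (\<lambda>_. count_space UNIV) (\<lambda>z \<omega>. Y z (restrict (\<lambda>i. ?X i \<omega>) (K z))) even_lattice"
    by (rule indep_vars_compose2)
       (auto simp: Y_def K_def intro!: site_state_measurable measurable_component_singleton)
  also have "?this \<longleftrightarrow> ?thesis"
    by (rule indep_vars_cong) (auto simp: Y_def K_def interval_state_def)
  finally show ?thesis .
qed

text \<open>
  Whether \<open>n\<close> is the first quiet index is decided by the waiting times, which are independent of
  the fair sign \<open>U z n\<close>; each index thus contributes equally to the states \<open>1\<close> and \<open>-1\<close>.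
\<close>
lemma prob_interval_state:
  assumes z: "z \<in> even_lattice"
  shows "prob {\<omega> \<in> space M. interval_state s \<delta> z \<omega> = 1} = prob {\<omega> \<in> space M. \<exists>n. quiet s \<delta> (\<lambda>i. W z i \<omega>) n} / 2"
    and "prob {\<omega> \<in> space M. interval_state s \<delta> z \<omega> = -1} = prob {\<omega> \<in> space M. \<exists>n. quiet s \<delta> (\<lambda>i. W z i \<omega>) n} / 2"
proof -
  let ?X = "\<lambda>i. case i of Inl (z, n) \<Rightarrow> W z n | Inr (z, n) \<Rightarrow> (\<lambda>\<omega>. real_of_int (U z n \<omega>))"
  define first where "first = (\<lambda>n w. quiet s \<delta> w n \<and> (\<forall>m<n. \<not> quiet s \<delta> w m))"
  define F where "F = (\<lambda>n. {\<omega> \<in> space M. first n (\<lambda>i. W z i \<omega>)})"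
  have first_meas: "Measurable.pred N (\<lambda>x. first n (w x))" if w: "\<And>n. (\<lambda>x. w x n) \<in> borel_measurable N"
    for n w and N :: "'x measure"
  proof -
    note [measurable] = quiet_measurable[OF w]
    show ?thesis unfolding first_def by measurable
  qed
  note [measurable] = first_meas[OF W_measurable[OF z]] value_measurable[OF z]
  have F_meas [measurable]: "F n \<in> sets M" for n unfolding F_def by measurable
  have half: "prob {\<omega> \<in> F n. U z n \<omega> \<in> S} = prob (F n) / 2" if S: "S = {1} \<or> S = - {1}" for n S
  proof -
    let ?A = "Inl ` ({z} \<times> UNIV) :: ((int \<times> int) \<times> nat + (int \<times> int) \<times> nat) set"
    let ?B = "{Inr (z, n)} :: ((int \<times> int) \<times> nat + (int \<times> int) \<times> nat) set"
    have "indep_var (PiM ?A (\<lambda>_. borel)) (\<lambda>\<omega>. restrict (\<lambda>i. ?X i \<omega>) ?A) (PiM ?B (\<lambda>_. borel)) (\<lambda>\<omega>. restrict (\<lambda>i. ?X i \<omega>) ?B)"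
      by (rule indep_var_restrict[OF indep]) (use z in auto)
    hence "indep_var borel ((\<lambda>x. if first n (\<lambda>k. x (Inl (z, k))) then 1 else 0 :: real) \<circ> (\<lambda>\<omega>. restrict (\<lambda>i. ?X i \<omega>) ?A))
       borel ((\<lambda>x. x (Inr (z, n))) \<circ> (\<lambda>\<omega>. restrict (\<lambda>i. ?X i \<omega>) ?B))"
    proof (rule indep_var_compose)
      have "Measurable.pred (PiM ?A (\<lambda>_. borel)) (\<lambda>x. first n (\<lambda>k. x (Inl (z, k))))"
        by (rule first_meas) (auto intro!: measurable_component_singleton)
      thus "(\<lambda>x. if first n (\<lambda>k. x (Inl (z, k))) then 1 else 0 :: real) \<in> borel_measurable (PiM ?A (\<lambda>_. borel))"
        by measurable
    qed (auto intro!: measurable_component_singleton)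
    hence ind: "indep_var borel (\<lambda>\<omega>. if first n (\<lambda>k. W z k \<omega>) then 1 else 0 :: real) borel (\<lambda>\<omega>. real_of_int (U z n \<omega>))"
      by (simp add: comp_def)
    have "prob ((\<lambda>\<omega>. (if first n (\<lambda>k. W z k \<omega>) then 1 else 0 :: real, real_of_int (U z n \<omega>))) -` ({1} \<times> real_of_int ` S) \<inter> space M) =
      prob ((\<lambda>\<omega>. if first n (\<lambda>k. W z k \<omega>) then 1 else 0 :: real) -` {1} \<inter> space M) * prob ((\<lambda>\<omega>. real_of_int (U z n \<omega>)) -` (real_of_int ` S) \<inter> space M)"
    proof (rule indep_varD[OF ind])
      have "countable (real_of_int ` S)" by (rule countable_image[OF countableI_type])
      thus "real_of_int ` S \<in> sets borel" by (rule sets.countable[rotated]) simp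
    qed simp
    also have "(\<lambda>\<omega>. (if first n (\<lambda>k. W z k \<omega>) then 1 else 0 :: real, real_of_int (U z n \<omega>))) -` ({1} \<times> real_of_int ` S) \<inter> space M = {\<omega> \<in> F n. U z n \<omega> \<in> S}"
      by (auto simp: F_def split: if_splits)
    also have "(\<lambda>\<omega>. if first n (\<lambda>k. W z k \<omega>) then 1 else 0 :: real) -` {1} \<inter> space M = F n" by (auto simp: F_def split: if_splits)
    also have "(\<lambda>\<omega>. real_of_int (U z n \<omega>)) -` (real_of_int ` S) \<inter> space M = {\<omega> \<in> space M. U z n \<omega> \<in> S}" by auto
    also have "prob {\<omega> \<in> space M. U z n \<omega> \<in> S} = 1 / 2"
    proof (cases "S = {1}")
      case False
      hence "prob {\<omega> \<in> space M. U z n \<omega> \<in> S} = prob (space M - {\<omega> \<in> space M. U z n \<omega> = 1})"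
        using S by (auto intro!: arg_cong[where f = prob])
      also have "\<dots> = 1 / 2" by (subst prob_compl) (auto simp: prob_value_1[OF z])
      finally show ?thesis .
    qed (use prob_value_1[OF z] in simp)
    finally show ?thesis by simp
  qed
  have disj: "first n w \<Longrightarrow> first m w \<Longrightarrow> n = m" for n m w
    unfolding first_def by (metis linorder_neqE_nat)
  have first_Least: "(LEAST n. quiet s \<delta> w n) = n" if "first n w" for n w
    using that unfolding first_def by (intro Least_equality) (auto simp: not_less[symmetric])
  have ex_first: "(\<exists>n. quiet s \<delta> w n) \<longleftrightarrow> (\<exists>n. first n w)" for w
  proof
    assume "\<exists>n. quiet s \<delta> w n"
    hence "first (LEAST n. quiet s \<delta> w n) w" unfolding first_def by (auto intro: LeastI_ex dest: not_less_Least)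
    thus "\<exists>n. first n w" ..
  qed (auto simp: first_def)
  have total: "(\<lambda>n. prob (F n)) sums prob {\<omega> \<in> space M. \<exists>n. quiet s \<delta> (\<lambda>i. W z i \<omega>) n}"
  proof -
    have "(\<lambda>n. prob (F n)) sums prob (\<Union>n. F n)"
      by (rule finite_measure_UNION) (auto simp: disjoint_family_on_def F_def dest: disj)
    also have "(\<Union>n. F n) = {\<omega> \<in> space M. \<exists>n. quiet s \<delta> (\<lambda>i. W z i \<omega>) n}"
      by (auto simp: F_def ex_first)
    finally show ?thesis .
  qed
  have part: "prob {\<omega> \<in> space M. \<exists>n. first n (\<lambda>i. W z i \<omega>) \<and> U z n \<omega> \<in> S} = prob {\<omega> \<in> space M. \<exists>n. quiet s \<delta> (\<lambda>i. W z i \<omega>) n} / 2"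
    if S: "S = {1} \<or> S = - {1}" for S
  proof -
    have "(\<lambda>n. prob {\<omega> \<in> F n. U z n \<omega> \<in> S}) sums prob (\<Union>n. {\<omega> \<in> F n. U z n \<omega> \<in> S})"
    proof (rule finite_measure_UNION)
      show "range (\<lambda>n. {\<omega> \<in> F n. U z n \<omega> \<in> S}) \<subseteq> sets M"
      proof safe
        fix n
        have "{\<omega> \<in> F n. U z n \<omega> \<in> S} = F n \<inter> {\<omega> \<in> space M. U z n \<omega> \<in> S}" by (auto simp: F_def)
        also have "\<dots> \<in> sets M" by measurable
        finally show "{\<omega> \<in> F n. U z n \<omega> \<in> S} \<in> sets M" .
      qed
    qed (auto simp: disjoint_family_on_def F_def dest: disj)
    also have "(\<Union>n. {\<omega> \<in> F n. U z n \<omega> \<in> S}) = {\<omega> \<in> space M. \<exists>n. first n (\<lambda>i. W z i \<omega>) \<and> U z n \<omega> \<in> S}"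
      by (auto simp: F_def)
    finally have "(\<lambda>n. prob (F n) / 2) sums prob {\<omega> \<in> space M. \<exists>n. first n (\<lambda>i. W z i \<omega>) \<and> U z n \<omega> \<in> S}"
      unfolding half[OF S] .
    moreover have "(\<lambda>n. prob (F n) / 2) sums (prob {\<omega> \<in> space M. \<exists>n. quiet s \<delta> (\<lambda>i. W z i \<omega>) n} / 2)"
      by (rule sums_divide[OF total])
    ultimately show ?thesis by (rule sums_unique2)
  qed
  have 1: "interval_state s \<delta> z \<omega> = 1 \<longleftrightarrow> (\<exists>n. first n (\<lambda>i. W z i \<omega>) \<and> U z n \<omega> \<in> {1})"
   and 2: "interval_state s \<delta> z \<omega> = -1 \<longleftrightarrow> (\<exists>n. first n (\<lambda>i. W z i \<omega>) \<and> U z n \<omega> \<in> - {1})" for \<omega>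
    using z by (auto simp: interval_state_def site_state_def ex_first first_Least split: if_splits) (metis disj)+
  show "prob {\<omega> \<in> space M. interval_state s \<delta> z \<omega> = 1} = prob {\<omega> \<in> space M. \<exists>n. quiet s \<delta> (\<lambda>i. W z i \<omega>) n} / 2"
    unfolding 1 by (rule part) simp
  show "prob {\<omega> \<in> space M. interval_state s \<delta> z \<omega> = -1} = prob {\<omega> \<in> space M. \<exists>n. quiet s \<delta> (\<lambda>i. W z i \<omega>) n} / 2"
    unfolding 2 by (rule part) simp
qed

lemma interval_state_field:
  assumes "0 \<le> s" "0 \<le> \<delta>"
  shows "three_valued_field M (interval_state s \<delta>) \<delta>"
proof unfold_locales
  fix z assume z: "z \<in> even_lattice"
  show "prob {\<omega> \<in> space M. interval_state s \<delta> z \<omega> = -1} = prob {\<omega> \<in> space M. interval_state s \<delta> z \<omega> = 1}"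
    by (simp only: prob_interval_state[OF z])
  note [measurable] = quiet_measurable[where w = "\<lambda>\<omega> i. W z i \<omega>", OF W_measurable[OF z]]
  have "prob (space M - {\<omega> \<in> space M. \<forall>n. \<not> quiet s \<delta> (\<lambda>i. W z i \<omega>) n}) = 1 - prob {\<omega> \<in> space M. \<forall>n. \<not> quiet s \<delta> (\<lambda>i. W z i \<omega>) n}"
    by (rule prob_compl) measurable
  moreover have "space M - {\<omega> \<in> space M. \<forall>n. \<not> quiet s \<delta> (\<lambda>i. W z i \<omega>) n} = {\<omega> \<in> space M. \<exists>n. quiet s \<delta> (\<lambda>i. W z i \<omega>) n}"
    by auto
  ultimately show "(1 - \<delta>) / 2 \<le> prob {\<omega> \<in> space M. interval_state s \<delta> z \<omega> = 1}"
    unfolding prob_interval_state[OF z] using prob_not_quiet[OF z assms] by simp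
qed (auto simp: interval_state_measurable interval_state_indep interval_state_def site_state_def)

end

section \<open>Covering the exceptional times\<close>

definition inside_barriers :: "real \<Rightarrow> real \<Rightarrow> real \<Rightarrow> nat \<Rightarrow> int \<Rightarrow> int \<Rightarrow> bool" where
  "inside_barriers j K1 K2 t a b \<longleftrightarrow> - j - K1 * sqrt (real t) \<le> real_of_int a \<and> real_of_int b \<le> j + K2 * sqrt (real t)"

text \<open>
  Reflection turns the lower barrier for the upper walk into an upper barrier, so both factors are
  barrier functions of the same kind.
\<close>
lemma (in three_valued_field) prob_inside_barriers_bound:
  fixes F1 F2 :: "nat \<Rightarrow> real \<Rightarrow> real" and j K1 K2 c1 c2 q1 q2 :: real and C1 C2 :: "nat \<Rightarrow> real"
  assumes t0: "t0 \<le> n" and c: "0 < c1" "0 < c2" and K: "0 \<le> K1" "0 \<le> K2"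
    and anti1: "\<And>t. antimono (F1 t)" and anti2: "\<And>t. antimono (F2 t)"
    and step1: "\<And>t x \<alpha>. (1 - \<delta>) / 2 \<le> \<alpha> \<Longrightarrow> \<alpha> * F1 (Suc t) (x + 1) + (1 - \<alpha>) * F1 (Suc t) (x - 1) \<le> F1 t x"
    and step2: "\<And>t x \<alpha>. (1 - \<delta>) / 2 \<le> \<alpha> \<Longrightarrow> \<alpha> * F2 (Suc t) (x + 1) + (1 - \<alpha>) * F2 (Suc t) (x - 1) \<le> F2 t x"
    and low1: "\<And>t x. t0 \<le> t \<Longrightarrow> t \<le> n \<Longrightarrow> x \<le> j + 1 + K1 * sqrt (real t) \<Longrightarrow> c1 * sqrt (real t) powr q1 \<le> F1 t x"
    and low2: "\<And>t x. t0 \<le> t \<Longrightarrow> t \<le> n \<Longrightarrow> x \<le> j + 1 + K2 * sqrt (real t) \<Longrightarrow> c2 * sqrt (real t) powr q2 \<le> F2 t x"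
    and start1: "\<And>t. F1 t (- real t) \<le> C1 t" and start2: "\<And>t. F2 t (- real t) \<le> C2 t"
  shows "c1 * c2 * sqrt (real n) powr (q1 + q2) * prob (alive (inside_barriers j K1 K2) t0 n) \<le> \<bar>C1 t0\<bar> * \<bar>C2 t0\<bar>"
proof -
  have nonneg1: "0 \<le> F1 t x" if "t0 \<le> t" "t \<le> n" "x \<le> j + 1 + K1 * sqrt (real t)" for t x
    by (rule order_trans[OF _ low1[OF that]]) (use c in simp)
  have nonneg2: "0 \<le> F2 t x" if "t0 \<le> t" "t \<le> n" "x \<le> j + 1 + K2 * sqrt (real t)" for t x
    by (rule order_trans[OF _ low2[OF that]]) (use c in simp)
  have sq: "K1 * sqrt (real t) \<le> K1 * sqrt (real (Suc t))" "K2 * sqrt (real t) \<le> K2 * sqrt (real (Suc t))" for t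
    using K by (auto intro!: mult_left_mono)
  define f where "f = (\<lambda>t a. F1 t (- real_of_int a))"
  define g where "g = (\<lambda>t b. F2 t (real_of_int b))"
  show ?thesis
  proof (rule prob_alive_bound[OF t0, of f g])
    show "mono (f t)" for t unfolding f_def by (intro monoI antimonoD[OF anti1]) simp
    show "antimono (g t)" for t unfolding g_def by (intro antimonoI antimonoD[OF anti2]) simp
    show "\<alpha> * f (Suc t) (a - 1) + (1 - \<alpha>) * f (Suc t) (a + 1) \<le> f t a" if "(1 - \<delta>) / 2 \<le> \<alpha>" for \<alpha> t a
    proof -
      have "- real_of_int (a - 1) = - real_of_int a + 1" "- real_of_int (a + 1) = - real_of_int a - 1" by simp_all
      thus ?thesis using step1[OF that, of t "- real_of_int a"] by (simp only: f_def)
    qed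
    show "\<alpha> * g (Suc t) (b + 1) + (1 - \<alpha>) * g (Suc t) (b - 1) \<le> g t b" if "(1 - \<delta>) / 2 \<le> \<alpha>" for \<alpha> t b
      using step2[OF that, of t "real_of_int b"] by (simp add: g_def algebra_simps)
    show "0 \<le> f t a \<and> 0 \<le> f (Suc t) (a - 1) \<and> 0 \<le> f (Suc t) (a + 1) \<and> 0 \<le> g (Suc t) (b - 1) \<and> 0 \<le> g (Suc t) (b + 1)"
      if "t0 \<le> t" "t < n" "inside_barriers j K1 K2 t a b" for t a b
      unfolding f_def g_def using that sq[of t]
      by (intro conjI nonneg1 nonneg2) (auto simp: inside_barriers_def simp del: of_nat_Suc)
    show "f t0 a * g t0 b \<le> \<bar>C1 t0\<bar> * \<bar>C2 t0\<bar>"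
      if "inside_barriers j K1 K2 t0 a b" "\<bar>a\<bar> \<le> int t0" "\<bar>b\<bar> \<le> int t0" for a b
    proof (rule mult_mono)
      have ab: "- real t0 \<le> - real_of_int a" "- real t0 \<le> real_of_int b" using that by linarith+
      have "f t0 a \<le> C1 t0" unfolding f_def by (rule order_trans[OF antimonoD[OF anti1 ab(1)] start1])
      thus "f t0 a \<le> \<bar>C1 t0\<bar>" by simp
      have "g t0 b \<le> C2 t0" unfolding g_def by (rule order_trans[OF antimonoD[OF anti2 ab(2)] start2])
      thus "g t0 b \<le> \<bar>C2 t0\<bar>" by simp
      show "0 \<le> g t0 b" unfolding g_def by (rule nonneg2) (use that t0 in \<open>auto simp: inside_barriers_def\<close>)
    qed simp
    show "c1 * c2 * sqrt (real n) powr (q1 + q2) \<le> f n a * g n b" if "inside_barriers j K1 K2 n a b" for a b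
    proof -
      have "(c1 * sqrt (real n) powr q1) * (c2 * sqrt (real n) powr q2) \<le> f n a * g n b"
        unfolding f_def g_def
      proof (rule mult_mono)
        show "c1 * sqrt (real n) powr q1 \<le> F1 n (- real_of_int a)"
          by (rule low1) (use that t0 in \<open>auto simp: inside_barriers_def\<close>)
        show "c2 * sqrt (real n) powr q2 \<le> F2 n (real_of_int b)"
          by (rule low2) (use that t0 in \<open>auto simp: inside_barriers_def\<close>)
        show "0 \<le> F1 n (- real_of_int a)"
          by (rule nonneg1) (use that t0 in \<open>auto simp: inside_barriers_def\<close>)
      qed (use c in simp)
      thus ?thesis by (simp add: powr_add mult_ac)
    qed
  qed simp
qed

context dynamical_discrete_web
begin

definition evolves :: "'w \<Rightarrow> bool" where
  "evolves \<omega> \<longleftrightarrow> (\<forall>z\<in>even_lattice. \<forall>n \<tau>.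
         ring_time (\<lambda>i. W z i \<omega>) n \<le> \<tau> \<and> \<tau> < ring_time (\<lambda>i. W z i \<omega>) (Suc n) \<longrightarrow>
         \<xi> z \<tau> \<omega> = U z n \<omega>)"

lemma arrow_between:
  assumes \<omega>: "\<omega> \<in> space M" "evolves \<omega>" and z: "z \<in> even_lattice" and \<tau>: "0 \<le> s" "s \<le> \<tau>" "\<tau> \<le> s + \<delta>"
  shows "lower_arrow (interval_state s \<delta> z \<omega>) \<le> \<xi> z \<tau> \<omega>" "\<xi> z \<tau> \<omega> \<le> upper_arrow (interval_state s \<delta> z \<omega>)"
proof -
  let ?q = "quiet s \<delta> (\<lambda>i. W z i \<omega>)"
  have v: "\<xi> z \<tau> \<omega> \<in> {-1, 1}" using process_values[OF z _ \<omega>(1), of \<tau>] \<tau> by simp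
  have "lower_arrow (interval_state s \<delta> z \<omega>) \<le> \<xi> z \<tau> \<omega> \<and> \<xi> z \<tau> \<omega> \<le> upper_arrow (interval_state s \<delta> z \<omega>)"
  proof (cases "\<exists>n. ?q n")
    case True
    define n where "n = (LEAST n. ?q n)"
    have "?q n" unfolding n_def using True by (rule LeastI_ex)
    hence "ring_time (\<lambda>i. W z i \<omega>) n \<le> \<tau>" "\<tau> < ring_time (\<lambda>i. W z i \<omega>) (Suc n)"
      using \<tau> by (auto simp: quiet_def)
    hence "\<xi> z \<tau> \<omega> = U z n \<omega>" using \<omega>(2) z unfolding evolves_def by blast
    moreover have "interval_state s \<delta> z \<omega> = (if U z n \<omega> = 1 then 1 else -1)"
      using z True by (simp add: interval_state_def site_state_def n_def)
    ultimately show ?thesis using v by (auto simp: lower_arrow_def upper_arrow_def)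
  next
    case False
    hence "interval_state s \<delta> z \<omega> = 0" by (simp add: interval_state_def site_state_def)
    thus ?thesis using v by (auto simp: lower_arrow_def upper_arrow_def)
  qed
  thus "lower_arrow (interval_state s \<delta> z \<omega>) \<le> \<xi> z \<tau> \<omega>" "\<xi> z \<tau> \<omega> \<le> upper_arrow (interval_state s \<delta> z \<omega>)" by auto
qed

definition interval_alive :: "real \<Rightarrow> real \<Rightarrow> real \<Rightarrow> nat \<Rightarrow> nat \<Rightarrow> real \<Rightarrow> real \<Rightarrow> 'w set" where
  "interval_alive j K1 K2 t0 n s \<delta> = three_valued_field.alive M (interval_state s \<delta>) (inside_barriers j K1 K2) t0 n"

lemma S0_at_integer: "S0 \<xi> \<tau> \<omega> (real t) = real_of_int (walk (\<lambda>z. \<xi> z \<tau> \<omega>) t)"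
  by (simp add: S0_def interpolate_def frac_def)

lemma exceptional_subset_alive:
  assumes \<omega>: "\<omega> \<in> space M" "evolves \<omega>" and \<tau>: "0 \<le> s" "0 \<le> \<delta>" "s \<le> \<tau>" "\<tau> \<le> s + \<delta>"
    and stays: "\<And>t. 0 \<le> t \<Longrightarrow> - j - K1 * sqrt t \<le> S0 \<xi> \<tau> \<omega> t \<and> S0 \<xi> \<tau> \<omega> t \<le> j + K2 * sqrt t"
  shows "\<omega> \<in> interval_alive j K1 K2 t0 n s \<delta>"
proof -
  interpret Y: three_valued_field M "interval_state s \<delta>" \<delta> by (rule interval_state_field[OF \<tau>(1,2)])
  have "inside_barriers j K1 K2 t (Y.upper_walk t \<omega>) (Y.lower_walk t \<omega>)" for t
  proof -
    have v: "\<xi> z \<tau> \<omega> \<in> {-1, 1}" if "z \<in> even_lattice" for z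
      using process_values[OF that _ \<omega>(1), of \<tau>] \<tau> by simp
    note b = arrow_between[OF \<omega> _ \<tau>(1,3,4)]
    have "Y.lower_walk t \<omega> \<le> walk (\<lambda>z. \<xi> z \<tau> \<omega>) t" unfolding Y.lower_walk_def
      by (rule walk_mono) (use b v in \<open>auto simp: lower_arrow_def\<close>)
    moreover have "walk (\<lambda>z. \<xi> z \<tau> \<omega>) t \<le> Y.upper_walk t \<omega>" unfolding Y.upper_walk_def
      by (rule walk_mono) (use b v in \<open>auto simp: upper_arrow_def\<close>)
    ultimately show ?thesis
      using stays[of "real t"] unfolding inside_barriers_def S0_at_integer by auto
  qed
  thus ?thesis using \<omega>(1) by (simp add: interval_alive_def Y.alive_def)
qed

definition exceptional :: "real \<Rightarrow> real \<Rightarrow> real \<Rightarrow> 'w set" where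
  "exceptional j K1 K2 = {\<omega> \<in> space M. \<exists>\<tau>\<in>{0..1}. \<forall>t\<ge>0.
     - j - K1 * sqrt t \<le> S0 \<xi> \<tau> \<omega> t \<and> S0 \<xi> \<tau> \<omega> t \<le> j + K2 * sqrt t}"

lemma interval_alive_measurable:
  assumes "0 \<le> s" "0 \<le> \<delta>"
  shows "interval_alive j K1 K2 t0 n s \<delta> \<in> sets M"
proof -
  interpret Y: three_valued_field M "interval_state s \<delta>" \<delta> by (rule interval_state_field[OF assms])
  show ?thesis unfolding interval_alive_def by (rule Y.alive_measurable)
qed

lemma exceptional_subset_Union:
  assumes N: "0 < N" and \<omega>: "\<omega> \<in> exceptional j K1 K2" "evolves \<omega>"
  shows "\<omega> \<in> (\<Union>k<N. interval_alive j K1 K2 t0 n (real k / real N) (1 / real N))"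
proof -
  from \<omega>(1) obtain \<tau> where \<tau>: "0 \<le> \<tau>" "\<tau> \<le> 1" and sp: "\<omega> \<in> space M"
    and stays: "\<And>t. 0 \<le> t \<Longrightarrow> - j - K1 * sqrt t \<le> S0 \<xi> \<tau> \<omega> t \<and> S0 \<xi> \<tau> \<omega> t \<le> j + K2 * sqrt t"
    by (auto simp: exceptional_def)
  \<comment> \<open>The minimum only matters for \<open>\<tau> = 1\<close>, which is the right end point of the last interval.\<close>
  define k where "k = min (nat \<lfloor>\<tau> * real N\<rfloor>) (N - 1)"
  have k: "k < N" using N by (auto simp: k_def)
  have fl: "real (nat \<lfloor>\<tau> * real N\<rfloor>) \<le> \<tau> * real N" "\<tau> * real N < real (nat \<lfloor>\<tau> * real N\<rfloor>) + 1"
    using \<tau> by (simp_all add: of_nat_nat)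
  have "real k \<le> \<tau> * real N" using fl(1) by (simp add: k_def min_def split: if_splits)
  hence 1: "real k / real N \<le> \<tau>" using N by (simp add: field_simps)
  have "\<tau> * real N \<le> real k + 1"
  proof (cases "nat \<lfloor>\<tau> * real N\<rfloor> \<le> N - 1")
    case True
    thus ?thesis using fl(2) by (simp add: k_def)
  next
    case False
    hence "real k + 1 = real N" using N by (simp add: k_def min_def of_nat_diff)
    thus ?thesis using \<tau>(2) N by (simp add: mult_left_le_one_le)
  qed
  hence 2: "\<tau> \<le> real k / real N + 1 / real N" using N by (simp add: field_simps)
  have "\<omega> \<in> interval_alive j K1 K2 t0 n (real k / real N) (1 / real N)"
    by (rule exceptional_subset_alive[OF sp \<omega>(2) _ _ 1 2 stays]) auto
  thus ?thesis using k by blast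
qed

text \<open>
  With \<open>N = L * m\<close> intervals of length \<open>1 / N\<close> and walks run up to time \<open>m\<^sup>2\<close>, the fixed factor \<open>L\<close> makes
  the drift \<open>1 / N\<close> small enough compared with \<open>1 / m\<close>, and the number of intervals still grows only
  like \<open>m\<close>.
\<close>
lemma exceptional_cover_bound:
  assumes K: "0 < K1" "0 < K2" and isp: "is_p K1 p1" "is_p K2 p2" and p12: "p1 + p2 > 1" and j: "0 \<le> j"
  shows "\<exists>r>0. \<exists>D m0. \<forall>m\<ge>m0. \<exists>B\<in>sets M. {\<omega> \<in> exceptional j K1 K2. evolves \<omega>} \<subseteq> B \<and> prob B \<le> D * real m powr (- r)"
proof -
  have p: "0 < p1" "0 < p2" using isp by (auto simp: is_p_def)
  \<comment> \<open>Lowering both exponents by a quarter of the excess \<open>p1 + p2 - 1\<close> keeps their sum above \<open>1\<close>;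
    the other bound keeps them positive.\<close>
  define \<eta> where "\<eta> = min (min p1 p2 / 2) ((p1 + p2 - 1) / 4)"
  define q1 where "q1 = p1 - \<eta>"
  define q2 where "q2 = p2 - \<eta>"
  have \<eta>: "0 < \<eta>" "\<eta> \<le> p1 / 2" "\<eta> \<le> p2 / 2" using p p12 by (auto simp: \<eta>_def)
  have \<eta>4: "\<eta> \<le> (p1 + p2 - 1) / 4" unfolding \<eta>_def by (rule min.cobounded2)
  have q: "0 < q1" "q1 < p1" "0 < q2" "q2 < p2" "q1 + q2 > 1" using \<eta> \<eta>4 p p12 by (auto simp: q1_def q2_def)
  obtain \<epsilon>1 T1 c1 C1 where 1: "\<epsilon>1 > 0" "c1 > 0"
    and F1: "\<And>m \<delta>. 0 < m \<Longrightarrow> 0 \<le> \<delta> \<Longrightarrow> \<delta> \<le> \<epsilon>1 / real m \<Longrightarrow> (\<exists>F :: nat \<Rightarrow> real \<Rightarrow> real.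
       (\<forall>t. antimono (F t)) \<and>
       (\<forall>t x \<alpha>. (1 - \<delta>) / 2 \<le> \<alpha> \<longrightarrow> \<alpha> * F (Suc t) (x + 1) + (1 - \<alpha>) * F (Suc t) (x - 1) \<le> F t x) \<and>
       (\<forall>t x. T1 \<le> t \<longrightarrow> t \<le> m\<^sup>2 \<longrightarrow> x \<le> j + 1 + K1 * sqrt (real t) \<longrightarrow> c1 * sqrt (real t) powr q1 \<le> F t x) \<and>
       (\<forall>t. F t (- real t) \<le> C1 t))"
    using barrier_supermartingale[OF isp(1) K(1) q(1,2) j] by metis
  obtain \<epsilon>2 T2 c2 C2 where 2: "\<epsilon>2 > 0" "c2 > 0"
    and F2: "\<And>m \<delta>. 0 < m \<Longrightarrow> 0 \<le> \<delta> \<Longrightarrow> \<delta> \<le> \<epsilon>2 / real m \<Longrightarrow> (\<exists>F :: nat \<Rightarrow> real \<Rightarrow> real.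
       (\<forall>t. antimono (F t)) \<and>
       (\<forall>t x \<alpha>. (1 - \<delta>) / 2 \<le> \<alpha> \<longrightarrow> \<alpha> * F (Suc t) (x + 1) + (1 - \<alpha>) * F (Suc t) (x - 1) \<le> F t x) \<and>
       (\<forall>t x. T2 \<le> t \<longrightarrow> t \<le> m\<^sup>2 \<longrightarrow> x \<le> j + 1 + K2 * sqrt (real t) \<longrightarrow> c2 * sqrt (real t) powr q2 \<le> F t x) \<and>
       (\<forall>t. F t (- real t) \<le> C2 t))"
    using barrier_supermartingale[OF isp(2) K(2) q(3,4) j] by metis
  define t0 where "t0 = max T1 T2"
  define L where "L = Suc (nat \<lceil>1 / min \<epsilon>1 \<epsilon>2\<rceil>)"
  have L: "0 < L" "1 / real L \<le> \<epsilon>1" "1 / real L \<le> \<epsilon>2"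
  proof -
    have "1 / min \<epsilon>1 \<epsilon>2 \<le> real L" unfolding L_def by linarith
    moreover have "0 < min \<epsilon>1 \<epsilon>2" using 1 2 by simp
    moreover have "0 < real L" unfolding L_def by (simp del: of_nat_Suc)
    ultimately have "1 / real L \<le> min \<epsilon>1 \<epsilon>2" by (metis pos_divide_le_eq mult.commute)
    thus "1 / real L \<le> \<epsilon>1" "1 / real L \<le> \<epsilon>2" by auto
  qed (simp add: L_def)
  define D where "D = real L * (\<bar>C1 t0\<bar> * \<bar>C2 t0\<bar> / (c1 * c2))"
  define r where "r = q1 + q2 - 1"
  have "\<exists>B\<in>sets M. {\<omega> \<in> exceptional j K1 K2. evolves \<omega>} \<subseteq> B \<and> prob B \<le> D * real m powr (- r)"
    if m: "m \<ge> max 1 t0" for m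
  proof -
    have m1: "0 < m" using m by simp
    have "m * 1 \<le> m * m" using m1 by (intro mult_le_mono2) simp
    hence tm: "t0 \<le> m\<^sup>2" using m unfolding power2_eq_square by linarith
    define N where "N = L * m"
    have N: "0 < N" using L m1 by (simp add: N_def)
    define \<delta> where "\<delta> = 1 / real N"
    have \<delta>: "0 \<le> \<delta>" "\<delta> \<le> \<epsilon>1 / real m" "\<delta> \<le> \<epsilon>2 / real m"
      using L m1 by (auto simp: \<delta>_def N_def field_simps)
    obtain G1 where G1: "\<And>t. antimono (G1 t)"
       "\<And>t x \<alpha>. (1 - \<delta>) / 2 \<le> \<alpha> \<Longrightarrow> \<alpha> * G1 (Suc t) (x + 1) + (1 - \<alpha>) * G1 (Suc t) (x - 1) \<le> G1 t x"
       "\<And>t x. T1 \<le> t \<Longrightarrow> t \<le> m\<^sup>2 \<Longrightarrow> x \<le> j + 1 + K1 * sqrt (real t) \<Longrightarrow> c1 * sqrt (real t) powr q1 \<le> G1 t x"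
       "\<And>t. G1 t (- real t) \<le> C1 t"
      using F1[OF m1 \<delta>(1,2)] by blast
    obtain G2 where G2: "\<And>t. antimono (G2 t)"
       "\<And>t x \<alpha>. (1 - \<delta>) / 2 \<le> \<alpha> \<Longrightarrow> \<alpha> * G2 (Suc t) (x + 1) + (1 - \<alpha>) * G2 (Suc t) (x - 1) \<le> G2 t x"
       "\<And>t x. T2 \<le> t \<Longrightarrow> t \<le> m\<^sup>2 \<Longrightarrow> x \<le> j + 1 + K2 * sqrt (real t) \<Longrightarrow> c2 * sqrt (real t) powr q2 \<le> G2 t x"
       "\<And>t. G2 t (- real t) \<le> C2 t"
      using F2[OF m1 \<delta>(1,3)] by blast
    define A where "A = (\<lambda>k. interval_alive j K1 K2 t0 (m\<^sup>2) (real k / real N) \<delta>)"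
    have A_meas: "A k \<in> sets M" for k unfolding A_def by (rule interval_alive_measurable) (use \<delta> in auto)
    have A_prob: "prob (A k) \<le> \<bar>C1 t0\<bar> * \<bar>C2 t0\<bar> / (c1 * c2) * real m powr (- (q1 + q2))" for k
    proof -
      interpret Y: three_valued_field M "interval_state (real k / real N) \<delta>" \<delta>
        by (rule interval_state_field) (use \<delta> in auto)
      have "c1 * c2 * sqrt (real (m\<^sup>2)) powr (q1 + q2) * prob (Y.alive (inside_barriers j K1 K2) t0 (m\<^sup>2)) \<le> \<bar>C1 t0\<bar> * \<bar>C2 t0\<bar>"
        by (rule Y.prob_inside_barriers_bound[of t0 "m\<^sup>2" c1 c2 K1 K2 G1 G2 j q1 q2 C1 C2])
           (use tm 1 2 K G1 G2 in \<open>auto simp: t0_def\<close>)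
      moreover have "sqrt (real (m\<^sup>2)) = real m" by simp
      ultimately have "c1 * c2 * real m powr (q1 + q2) * prob (A k) \<le> \<bar>C1 t0\<bar> * \<bar>C2 t0\<bar>"
        by (simp only: A_def interval_alive_def)
      moreover have "c1 * c2 * real m powr (q1 + q2) > 0" using 1 2 m1 by simp
      ultimately have "prob (A k) \<le> \<bar>C1 t0\<bar> * \<bar>C2 t0\<bar> / (c1 * c2 * real m powr (q1 + q2))"
        by (simp add: pos_le_divide_eq mult.commute)
      also have "\<dots> = \<bar>C1 t0\<bar> * \<bar>C2 t0\<bar> / (c1 * c2) * real m powr (- (q1 + q2))"
        by (simp only: powr_minus divide_inverse inverse_mult_distrib mult_ac)
      finally show ?thesis .
    qed
    show ?thesis
    proof (intro bexI[of _ "\<Union>k<N. A k"] conjI)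
      show "{\<omega> \<in> exceptional j K1 K2. evolves \<omega>} \<subseteq> (\<Union>k<N. A k)"
        unfolding A_def \<delta>_def using exceptional_subset_Union[OF N] by blast
      show "(\<Union>k<N. A k) \<in> sets M" using A_meas by auto
      have "prob (\<Union>k<N. A k) \<le> (\<Sum>k<N. prob (A k))"
        by (rule finite_measure_subadditive_finite) (use A_meas in auto)
      also have "\<dots> \<le> (\<Sum>k<N. \<bar>C1 t0\<bar> * \<bar>C2 t0\<bar> / (c1 * c2) * real m powr (- (q1 + q2)))"
        by (intro sum_mono A_prob)
      also have "\<dots> = D * (real m powr 1 * real m powr (- (q1 + q2)))"
        using m1 by (simp add: N_def D_def)
      also have "real m powr 1 * real m powr (- (q1 + q2)) = real m powr (- r)"
        by (subst powr_add[symmetric]) (simp add: r_def algebra_simps)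
      finally show "prob (\<Union>k<N. A k) \<le> D * real m powr (- r)" .
    qed
  qed
  moreover have "r > 0" using q by (simp add: r_def)
  ultimately show ?thesis by blast
qed

text \<open>
  The exceptional set need not be measurable as it stands, being an uncountable union over \<open>\<tau>\<close>. Outside the
  null set where the evolution rule fails it lies in measurable sets of arbitrarily small
  probability.
\<close>
lemma exceptional_null:
  assumes "0 < K1" "0 < K2" "is_p K1 p1" "is_p K2 p2" "p1 + p2 > 1" "0 \<le> j"
  shows "exceptional j K1 K2 \<in> null_sets (completion M)"
proof -
  obtain r D m0 where r: "r > 0"
    and cover: "\<And>m. m \<ge> m0 \<Longrightarrow> \<exists>B\<in>sets M. {\<omega> \<in> exceptional j K1 K2. evolves \<omega>} \<subseteq> B \<and> prob B \<le> D * real m powr (- r)"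
    using exceptional_cover_bound[OF assms] by metis
  define B where "B = (\<lambda>m. SOME B. B \<in> sets M \<and> {\<omega> \<in> exceptional j K1 K2. evolves \<omega>} \<subseteq> B \<and> prob B \<le> D * real (m + m0) powr (- r))"
  have B: "B m \<in> sets M \<and> {\<omega> \<in> exceptional j K1 K2. evolves \<omega>} \<subseteq> B m \<and> prob (B m) \<le> D * real (m + m0) powr (- r)" for m
    unfolding B_def by (rule someI_ex) (use cover[of "m + m0"] in auto)
  have "(\<lambda>m. real (m + m0) powr (- r)) \<longlonglongrightarrow> 0" using r by real_asymp
  hence "(\<lambda>m. D * real (m + m0) powr (- r)) \<longlonglongrightarrow> 0" by (rule tendsto_mult_right_zero)
  moreover have "prob (\<Inter>m. B m) \<le> D * real (m + m0) powr (- r)" for m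
  proof -
    have "prob (\<Inter>m. B m) \<le> prob (B m)" by (rule finite_measure_mono) (use B in auto)
    thus ?thesis using B[of m] by linarith
  qed
  ultimately have "prob (\<Inter>m. B m) \<le> 0" by (intro LIMSEQ_le_const) auto
  hence "prob (\<Inter>m. B m) = 0" by (simp add: measure_le_0_iff)
  moreover have "(\<Inter>m. B m) \<in> sets M" using B by auto
  ultimately have null: "(\<Inter>m. B m) \<in> null_sets M" by (simp add: null_sets_def emeasure_eq_measure)
  have "AE \<omega> in M. evolves \<omega>" unfolding evolves_def by (rule evolution)
  then obtain N where N: "{\<omega> \<in> space M. \<not> evolves \<omega>} \<subseteq> N" "N \<in> null_sets M"
    by (auto elim!: AE_E simp: null_sets_def)
  have "exceptional j K1 K2 \<subseteq> (\<Inter>m. B m) \<union> N"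
  proof
    fix \<omega> assume \<omega>: "\<omega> \<in> exceptional j K1 K2"
    show "\<omega> \<in> (\<Inter>m. B m) \<union> N"
    proof (cases "evolves \<omega>")
      case True
      thus ?thesis using \<omega> B by blast
    next
      case False
      thus ?thesis using \<omega> N(1) by (auto simp: exceptional_def)
    qed
  qed
  moreover have "(\<Inter>m. B m) \<union> N \<in> null_sets M" using null N(2) by (rule null_sets.Un)
  ultimately show ?thesis unfolding null_sets_completion_iff2 by blast
qed

end

theorem proposition5p5:
  fixes M :: "'w measure"
    and \<xi> :: "int \<times> int \<Rightarrow> real \<Rightarrow> 'w \<Rightarrow> int"
    and W :: "int \<times> int \<Rightarrow> nat \<Rightarrow> 'w \<Rightarrow> real"
    and U :: "int \<times> int \<Rightarrow> nat \<Rightarrow> 'w \<Rightarrow> int"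
    and K1 K2 p1 p2 j :: real
  assumes "dynamical_discrete_web M \<xi> W U"
    and "K1 > 0" and "K2 > 0"
    and "is_p K1 p1" and "is_p K2 p2"
    and "p1 + p2 > 1"
    and "j \<ge> 0"
  shows "{\<omega> \<in> space M. \<exists>\<tau>\<in>{0..1}. \<forall>t\<ge>0.
            - j - K1 * sqrt t \<le> S0 \<xi> \<tau> \<omega> t \<and> S0 \<xi> \<tau> \<omega> t \<le> j + K2 * sqrt t}
         \<in> null_sets (completion M)"
proof -
  interpret dynamical_discrete_web M \<xi> W U by fact
  show ?thesis using exceptional_null[OF assms(2-7)] unfolding exceptional_def .
qed

end
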